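(* Let $d \geq 1$ be an integer. There exists a compact subset $E$ of $\mathbb{R}^d$ such that $E$ has Hausdorff dimension $d$ and such that for any Borel measure $\mu$ on $\mathbb{R}^d$ with $\mu(E)>0$, any $p \in (1,2]$ and any $q \in [1,\infty]$ it holds that \[ \sup_{f \in \mathcal{S}(\mathbb{R}^d),\, f \neq 0} \frac{\|\hat f\|_{L^q(\mu)}}{\|f\|_{L^p(\mathbb{R}^d)}} = \infty. \]
   Context: $\mathcal{S}(\mathbb{R}^d)$ denotes the Schwartz space and $\hat f$ the Fourier transform of $f$. Borel measures are nonnegative. *)

theory Defs
  imports "HOL-Probability.Essential_Supremum"
begin

section \<open>Hausdorff dimension\<close>

text \<open>Contribution of one covering set. The real power has \<open>0 powr 0 = 0\<close>, whereas a nonempty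
  set (a singleton, in particular) has to contribute 1 when the exponent is 0.\<close>

definition diam_pow :: "real \<Rightarrow> 'a::metric_space set \<Rightarrow> ennreal" where
  "diam_pow s U = (if U = {} then 0 else if s = 0 then 1 else ennreal (diameter U powr s))"

text \<open>Boundedness is required of the covering sets because \<^const>\<open>diameter\<close> is real-valued
  and carries no information about unbounded sets.\<close>

definition hausdorff_premeasure :: "real \<Rightarrow> real \<Rightarrow> 'a::metric_space set \<Rightarrow> ennreal" where
  "hausdorff_premeasure s \<delta> A =
     Inf {(\<Sum>i. diam_pow s (U i)) | U :: nat \<Rightarrow> 'a set.
            A \<subseteq> (\<Union>i. U i) \<and> (\<forall>i. bounded (U i) \<and> diameter (U i) \<le> \<delta>)}"

definition hausdorff_measure :: "real \<Rightarrow> 'a::metric_space set \<Rightarrow> ennreal" where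
  "hausdorff_measure s A = (SUP \<delta>\<in>{0<..}. hausdorff_premeasure s \<delta> A)"

definition hausdorff_dim :: "'a::metric_space set \<Rightarrow> ennreal" where
  "hausdorff_dim A = (INF s\<in>{s::real. 0 \<le> s \<and> hausdorff_measure s A = 0}. ennreal s)"

section \<open>Schwartz functions and the Fourier transform\<close>

definition partial_deriv :: "'n::finite \<Rightarrow> (real^'n \<Rightarrow> complex) \<Rightarrow> real^'n \<Rightarrow> complex" where
  "partial_deriv i f x = frechet_derivative f (at x) (axis i 1)"

definition iter_partial :: "'n::finite list \<Rightarrow> (real^'n \<Rightarrow> complex) \<Rightarrow> real^'n \<Rightarrow> complex" where
  "iter_partial is f = foldr partial_deriv is f"

text \<open>Differentiability of all iterated partial derivatives gives their continuity, so this is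
  the usual class of infinitely differentiable functions.\<close>

definition smooth_fun :: "(real^'n::finite \<Rightarrow> complex) \<Rightarrow> bool" where
  "smooth_fun f \<longleftrightarrow> (\<forall>is x. iter_partial is f differentiable (at x))"

text \<open>The derivative multi-index is given as a list of coordinate directions; by symmetry of
  partial derivatives its order is immaterial.\<close>

definition schwartz_space :: "(real^'n::finite \<Rightarrow> complex) set" where
  "schwartz_space = {f. smooth_fun f \<and>
     (\<forall>(\<alpha> :: 'n \<Rightarrow> nat) is.
        bounded (range (\<lambda>x. complex_of_real (\<Prod>i\<in>UNIV. (x $ i) ^ \<alpha> i) * iter_partial is f x)))}"

definition fourier :: "(real^'n::finite \<Rightarrow> complex) \<Rightarrow> real^'n \<Rightarrow> complex" where
  "fourier f \<xi> = (LINT x|lborel. f x * cis (- (2 * pi * (x \<bullet> \<xi>))))"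

section \<open>Extended-valued Lebesgue norms\<close>

definition ennreal_powr :: "ennreal \<Rightarrow> real \<Rightarrow> ennreal" where
  "ennreal_powr a r = (if a = \<infinity> then \<infinity> else ennreal (enn2real a powr r))"

text \<open>Intended for exponents in \<open>[1,\<infinity>]\<close>.\<close>

definition Lp_norm :: "'a measure \<Rightarrow> ennreal \<Rightarrow> ('a \<Rightarrow> complex) \<Rightarrow> ennreal" where
  "Lp_norm M q g =
     (if q = \<infinity> then esssup M (\<lambda>x. ennreal (norm (g x)))
      else ennreal_powr (\<integral>\<^sup>+x. ennreal (norm (g x) powr enn2real q) \<partial>M) (1 / enn2real q))"

end

theory Submission
  imports Defs "HOL-Library.Discrete_Functions" "HOL-Real_Asymp.Real_Asymp"
begin

text \<open>Let \<open>E\<close> be the set of points of the unit cube all of whose coordinates have a zero binary digit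
  at every place outside the range of \<open>j \<mapsto> j + \<lfloor>log\<^sub>2 j\<rfloor>\<^sup>2\<close> (up to a harmless constant). The forbidden
  places have density zero, and moving the digits of \<open>u\<close> to the allowed places is a map into \<open>E\<close> whose
  inverse is Hoelder continuous of every exponent below 1; hence \<open>E\<close> has full dimension. On the other
  hand there are arbitrarily long runs of forbidden places, so that for every \<open>\<epsilon> > 0\<close> some scale \<open>1/N\<close>
  has \<open>E\<close> within \<open>\<epsilon>/N\<close> of the lattice \<open>(1/N)\<int>\<^sup>d\<close>. Averaging the \<open>M\<^sup>d\<close> translates of a narrow bump by
  the points of \<open>N{0,\<dots>,M-1}\<^sup>d\<close>, with \<open>M\<close> about \<open>1/\<epsilon>\<close>, gives a function whose
  Fourier integral has nearly constant phase at the points of \<open>E\<close>, so its transform is bounded below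
  on \<open>E\<close>, while its \<open>L\<^sup>p\<close> norm is of order \<open>M\<^bsup>-d(1-1/p)\<^esup>\<close>.\<close>

section \<open>Compactly supported smooth functions\<close>

text \<open>This family is closed under differentiation: every derivative of
  \<open>exp (- (1 / (t * (1 - t))))\<close>, extended by 0, is again of this form with another
  numerator and a higher exponent.\<close>

definition bump_fun :: "real poly \<Rightarrow> nat \<Rightarrow> real \<Rightarrow> real" where
  "bump_fun P k t =
     (if 0 < t \<and> t < 1 then poly P t / (t * (1 - t)) ^ k * exp (- (1 / (t * (1 - t)))) else 0)"

lemma power_div_fact_le_exp:
  fixes x :: real
  assumes "0 \<le> x"
  shows "x ^ n / fact n \<le> exp x"
proof -
  have s: "(\<lambda>n. x ^ n / fact n) sums exp x"
    using exp_converges[of x] by (simp add: divide_inverse mult.commute)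
  have "sum (\<lambda>n. x ^ n / fact n) {n} \<le> suminf (\<lambda>n. x ^ n / fact n)"
    by (rule sum_le_suminf) (use s assms in \<open>auto simp: sums_iff\<close>)
  then show ?thesis using s by (simp add: sums_iff)
qed

text \<open>The exponential outweighs the pole: with \<open>u = t * (1 - t)\<close>, the term of
  order \<open>k + 2\<close> in the series of \<open>exp (1 / u)\<close> cancels
  \<open>u ^ k\<close> and leaves \<open>u\<^sup>2\<close>. The quadratic bounds at 0 and 1 yield
  the derivatives there.\<close>

lemma bump_fun_bound:
  obtains C where "0 \<le> C" "\<And>t. \<bar>bump_fun P k t\<bar> \<le> C * t\<^sup>2" "\<And>t. \<bar>bump_fun P k t\<bar> \<le> C * (t - 1)\<^sup>2"
proof -
  have "compact (poly P ` {0..1})"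
    by (intro compact_continuous_image continuous_intros) auto
  then obtain B where B: "\<And>t. 0 \<le> t \<Longrightarrow> t \<le> 1 \<Longrightarrow> \<bar>poly P t\<bar> \<le> B"
    using compact_imp_bounded bounded_iff by (metis atLeastAtMost_iff image_eqI real_norm_def)
  have B0: "0 \<le> B" using B[of 0] by simp
  define C where "C = B * fact (k + 2)"
  have main: "\<bar>bump_fun P k t\<bar> \<le> C * (t * (1 - t))\<^sup>2" if t: "0 < t" "t < 1" for t
  proof -
    define u where "u = t * (1 - t)"
    have u: "0 < u" using t by (simp add: u_def)
    have "(1 / u) ^ (k + 2) / fact (k + 2) \<le> exp (1 / u)"
      by (rule power_div_fact_le_exp) (use u in simp)
    then have "1 / u ^ k * exp (- (1 / u)) \<le> fact (k + 2) * u\<^sup>2"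
      using u by (simp add: exp_minus field_simps power_add power_divide power2_eq_square del: fact_Suc)
    moreover have "\<bar>poly P t\<bar> \<le> B" using B t by simp
    moreover have "0 \<le> 1 / u ^ k * exp (- (1 / u))" using u by simp
    ultimately have "\<bar>poly P t\<bar> * (1 / u ^ k * exp (- (1 / u))) \<le> B * (fact (k + 2) * u\<^sup>2)"
      using B0 mult_mono by blast
    then show ?thesis
      using t u by (simp add: bump_fun_def C_def abs_mult mult.assoc flip: u_def)
  qed
  have C0: "0 \<le> C" using B0 by (simp add: C_def)
  have u1: "(t * (1 - t))\<^sup>2 \<le> t\<^sup>2" "(t * (1 - t))\<^sup>2 \<le> (t - 1)\<^sup>2" if "0 < t" "t < 1" for t :: real
  proof -
    have "(1 - t)\<^sup>2 \<le> 1" "t\<^sup>2 \<le> 1" using that by (simp_all add: power_le_one)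
    then show "(t * (1 - t))\<^sup>2 \<le> t\<^sup>2" "(t * (1 - t))\<^sup>2 \<le> (t - 1)\<^sup>2"
      using mult_right_mono[of "t\<^sup>2" 1 "(1 - t)\<^sup>2"] mult_left_mono[of "(1 - t)\<^sup>2" 1 "t\<^sup>2"]
      by (simp_all add: power_mult_distrib power2_commute)
  qed
  show ?thesis
  proof (rule that[OF C0])
    fix t
    have "\<bar>bump_fun P k t\<bar> \<le> C * t\<^sup>2 \<and> \<bar>bump_fun P k t\<bar> \<le> C * (t - 1)\<^sup>2"
    proof (cases "0 < t \<and> t < 1")
      case True
      then show ?thesis using main[of t] mult_left_mono[OF u1(1) C0, of t] mult_left_mono[OF u1(2) C0, of t] by auto
    next
      case False
      then show ?thesis using C0 by (auto simp: bump_fun_def)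
    qed
    then show "\<bar>bump_fun P k t\<bar> \<le> C * t\<^sup>2" "\<bar>bump_fun P k t\<bar> \<le> C * (t - 1)\<^sup>2" by auto
  qed
qed

lemma has_real_derivative_zero_quadratic:
  fixes f :: "real \<Rightarrow> real"
  assumes "\<And>t. \<bar>f t\<bar> \<le> C * (t - a)\<^sup>2"
  shows "(f has_real_derivative 0) (at a)"
proof -
  have fa: "f a = 0" using assms[of a] by simp
  have "((\<lambda>h. (f (a + h) - f a) / h) \<longlongrightarrow> 0) (at 0)"
  proof (rule Lim_null_comparison)
    show "\<forall>\<^sub>F h in at 0. norm ((f (a + h) - f a) / h) \<le> C * \<bar>h\<bar>"
    proof (rule eventually_at_topological[THEN iffD2], intro exI[of _ UNIV] conjI ballI impI)
      fix h :: real assume "h \<noteq> 0"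
      then show "norm ((f (a + h) - f a) / h) \<le> C * \<bar>h\<bar>"
        using assms[of "a + h"] by (simp add: fa abs_divide field_simps power2_eq_square)
    qed auto
    show "((\<lambda>h. C * \<bar>h\<bar>) \<longlongrightarrow> 0) (at 0)" by (auto intro!: tendsto_eq_intros)
  qed
  then show ?thesis by (simp add: DERIV_def)
qed

text \<open>Numerator of the derivative over the common denominator \<open>u ^ (k + 2)\<close>,
  where \<open>u = t * (1 - t)\<close> is \<open>[:0, 1, -1:]\<close> and its derivative is
  \<open>[:1, -2:]\<close>. The last summand comes from the exponential.\<close>

definition bump_deriv_poly :: "real poly \<Rightarrow> nat \<Rightarrow> real poly" where
  "bump_deriv_poly P k =
     pderiv P * [:0, 1, -1:]\<^sup>2 - smult (real k) (P * [:1, -2:] * [:0, 1, -1:]) + P * [:1, -2:]"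

text \<open>Only the endpoints need care: there the quadratic bounds give derivative 0, which is the
  value of the right-hand side. Inside, this is the quotient and chain rules; outside, the function
  is locally 0.\<close>

lemma bump_fun_has_derivative:
  "(bump_fun P k has_real_derivative bump_fun (bump_deriv_poly P k) (k + 2) t) (at t)"
proof -
  obtain C where C: "\<And>t. \<bar>bump_fun P k t\<bar> \<le> C * t\<^sup>2" "\<And>t. \<bar>bump_fun P k t\<bar> \<le> C * (t - 1)\<^sup>2"
    using bump_fun_bound by metis
  consider "t = 0" | "t = 1" | "0 < t" "t < 1" | "t < 0 \<or> 1 < t" by linarith
  then show ?thesis
  proof cases
    case 1
    then show ?thesis using has_real_derivative_zero_quadratic[of "bump_fun P k" C 0] C
      by (simp add: bump_fun_def[of _ "k + 2"] bump_fun_def[of _ "Suc (Suc k)"])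
  next
    case 2
    then show ?thesis using has_real_derivative_zero_quadratic[of "bump_fun P k" C 1] C
      by (simp add: bump_fun_def[of _ "k + 2"] bump_fun_def[of _ "Suc (Suc k)"])
  next
    case 3
    define u where "u = t * (1 - t)"
    have u: "u > 0" using 3 by (simp add: u_def)
    have u': "(( \<lambda>t. t * (1 - t)) has_real_derivative (1 - 2 * t)) (at t)"
      by (auto intro!: derivative_eq_intros)
    \<comment> \<open>For \<open>k = 0\<close> the truncated exponent \<open>k - 1\<close> is
      harmless because of the factor \<open>real k\<close>.\<close>
    have ku: "real k * u ^ (k - 1) = real k * u ^ k / u" using u by (cases k) auto
    define A where "A = (poly (pderiv P) t * u ^ k - (real k * u ^ (k - 1)) * (1 - 2 * t) * poly P t) / (u ^ k * u ^ k)"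
    have A: "((\<lambda>t. poly P t / (t * (1 - t)) ^ k) has_real_derivative A) (at t)"
      using DERIV_divide[OF poly_DERIV[of P t] DERIV_power[OF u', of k]] u 3
      by (simp add: u_def A_def mult.commute mult.left_commute)
    have A_eq: "A = (poly (pderiv P) t * u - real k * (1 - 2 * t) * poly P t) / u ^ Suc k"
    proof -
      have "(p * w - (c * w / u) * q * r) / (w * w) = (p * u - c * q * r) / (u * w)"
        if "w > 0" for p w c q r :: real
        using that u by (simp add: field_simps)
      from this[of "u ^ k"] show ?thesis unfolding A_def ku using u by simp
    qed
    define B where "B = exp (- (1 / u)) * ((1 - 2 * t) / u\<^sup>2)"
    have "((\<lambda>t. - (1 / (t * (1 - t)))) has_real_derivative (1 - 2 * t) / u\<^sup>2) (at t)"
      using DERIV_minus[OF DERIV_inverse_fun[OF u']] u 3 by (simp add: u_def divide_inverse power2_eq_square mult.commute mult.left_commute)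
    from DERIV_fun_exp[OF this]
    have B: "((\<lambda>t. exp (- (1 / (t * (1 - t))))) has_real_derivative B) (at t)"
      by (simp add: B_def u_def)
    have "A * exp (- (1 / u)) + B * (poly P t / u ^ k) = bump_fun (bump_deriv_poly P k) (k + 2) t"
    proof -
      have "A * exp (- (1 / u)) + B * (poly P t / u ^ k) =
          (poly (pderiv P) t * u\<^sup>2 - real k * (poly P t * (1 - 2 * t) * u) + poly P t * (1 - 2 * t))
          / u ^ (k + 2) * exp (- (1 / u))"
      proof -
        have "(p * u - c * q * r) / (u * w) * e + e * (q / u\<^sup>2) * (r / w)
            = (p * u\<^sup>2 - c * (r * q * u) + r * q) / (w * u\<^sup>2) * e" if "w > 0" for p w c q r e :: real
        proof -
          have "(p * u - c * q * r) / (u * w) = (p * u\<^sup>2 - c * (r * q * u)) / (w * u\<^sup>2)"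
            using that u by (simp add: frac_eq_eq) (simp add: algebra_simps power2_eq_square)
          moreover have "e * (q / u\<^sup>2) * (r / w) = r * q / (w * u\<^sup>2) * e" by (simp add: mult.commute mult.left_commute)
          ultimately show ?thesis by (simp only: distrib_right add_divide_distrib)
        qed
        from this[of "u ^ k"] show ?thesis using u by (simp only: A_eq B_def power_add power_Suc zero_less_power)
      qed
      moreover have "poly (bump_deriv_poly P k) t
          = poly (pderiv P) t * u\<^sup>2 - real k * (poly P t * (1 - 2 * t) * u) + poly P t * (1 - 2 * t)"
      proof -
        have "poly [:0, 1, -1:] t = u" "poly [:1, -2:] t = 1 - 2 * t" by (simp_all add: u_def algebra_simps)
        then show ?thesis unfolding bump_deriv_poly_def by (simp only: poly_add poly_diff poly_mult poly_smult poly_power)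
      qed
      ultimately show ?thesis using 3 by (simp only: bump_fun_def u_def if_True simp_thms)
    qed
    moreover have "((\<lambda>t. poly P t / (t * (1 - t)) ^ k * exp (- (1 / (t * (1 - t))))) has_real_derivative
        A * exp (- (1 / u)) + B * (poly P t / u ^ k)) (at t)"
      using DERIV_mult[OF A B] by (simp add: u_def)
    ultimately have "((\<lambda>t. poly P t / (t * (1 - t)) ^ k * exp (- (1 / (t * (1 - t))))) has_real_derivative
        bump_fun (bump_deriv_poly P k) (k + 2) t) (at t)" by simp
    then show ?thesis
      by (rule has_field_derivative_transform_within_open[where S = "{0<..<1}"])
         (use 3 in \<open>auto simp: bump_fun_def\<close>)
  next
    case 4
    have "((\<lambda>t. 0 :: real) has_real_derivative 0) (at t)" by simp
    then have "(bump_fun P k has_real_derivative 0) (at t)"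
      by (rule has_field_derivative_transform_within_open[where S = "{..<0} \<union> {1<..}"])
         (use 4 in \<open>auto simp: bump_fun_def\<close>)
    then show ?thesis using 4 by (auto simp: bump_fun_def[of _ "k + 2"] bump_fun_def[of _ "Suc (Suc k)"])
  qed
qed

section \<open>One-variable functions given together with all their derivatives\<close>

text \<open>Carrying all derivatives along lets smoothness and iterated partial derivatives be read
  off later by shifting indices. One radius serves all orders.\<close>

definition bump_tower :: "(nat \<Rightarrow> real \<Rightarrow> real) \<Rightarrow> bool" where
  "bump_tower H \<longleftrightarrow> (\<forall>k t. (H k has_real_derivative H (Suc k) t) (at t)) \<and>
     (\<exists>R. \<forall>k t. R < \<bar>t\<bar> \<longrightarrow> H k t = 0)"

text \<open>Numerators of the successive derivatives of the bump; each differentiation raises the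
  exponent of the denominator by 2, hence \<open>2 * k\<close>.\<close>

primrec bump_poly :: "nat \<Rightarrow> real poly" where
  "bump_poly 0 = 1"
| "bump_poly (Suc k) = bump_deriv_poly (bump_poly k) (2 * k)"

definition bump :: "nat \<Rightarrow> real \<Rightarrow> real" where
  "bump k = bump_fun (bump_poly k) (2 * k)"

lemma bump_0: "bump 0 t = (if 0 < t \<and> t < 1 then exp (- (1 / (t * (1 - t)))) else 0)"
  by (simp add: bump_def bump_fun_def)

lemma bump_nonneg: "0 \<le> bump 0 t" and bump_le_1: "bump 0 t \<le> 1"
  by (auto simp: bump_0)

lemma bump_tower_bump: "bump_tower bump"
  unfolding bump_tower_def
proof (intro conjI allI)
  show "(bump k has_real_derivative bump (Suc k) t) (at t)" for k t
    using bump_fun_has_derivative[of "bump_poly k" "2 * k" t] by (simp add: bump_def)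
  show "\<exists>R. \<forall>k t. R < \<bar>t\<bar> \<longrightarrow> bump k t = 0"
    by (rule exI[of _ 1]) (auto simp: bump_def bump_fun_def)
qed

lemma bump_tower_affine:
  assumes "bump_tower H" "c \<noteq> 0"
  shows "bump_tower (\<lambda>k t. c ^ k * H k (c * t + b))"
proof -
  obtain R where R: "\<And>k t. R < \<bar>t\<bar> \<Longrightarrow> H k t = 0"
    using assms by (auto simp: bump_tower_def)
  have H: "(H k has_real_derivative H (Suc k) t) (at t)" for k t
    using assms by (auto simp: bump_tower_def)
  show ?thesis
    unfolding bump_tower_def
  proof (intro conjI allI exI impI)
    fix k t
    show "((\<lambda>t. c ^ k * H k (c * t + b)) has_real_derivative c ^ Suc k * H (Suc k) (c * t + b)) (at t)"
      by (rule derivative_eq_intros DERIV_chain2[OF H] refl | simp)+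
  next
    fix k t assume "(R + \<bar>b\<bar>) / \<bar>c\<bar> < \<bar>t\<bar>"
    then have "R < \<bar>c * t\<bar> - \<bar>b\<bar>" using assms(2) by (simp add: field_simps abs_mult)
    then have "R < \<bar>c * t + b\<bar>" by linarith
    then show "c ^ k * H k (c * t + b) = 0" by (simp add: R)
  qed
qed

lemma bump_tower_cmult:
  assumes "bump_tower H"
  shows "bump_tower (\<lambda>k t. c * H k t)"
  unfolding bump_tower_def
proof (intro conjI allI)
  show "((\<lambda>t. c * H k t) has_real_derivative c * H (Suc k) t) (at t)" for k t
    by (rule DERIV_cmult) (use assms in \<open>simp add: bump_tower_def\<close>)
  obtain R where "\<And>k t. R < \<bar>t\<bar> \<Longrightarrow> H k t = 0"
    using assms by (auto simp: bump_tower_def)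
  then show "\<exists>R. \<forall>k t. R < \<bar>t\<bar> \<longrightarrow> c * H k t = 0"
    by (intro exI[of _ R]) auto
qed

lemma bump_tower_sum:
  assumes "finite I" "\<And>i. i \<in> I \<Longrightarrow> bump_tower (H i)"
  shows "bump_tower (\<lambda>k t. \<Sum>i\<in>I. H i k t)"
proof -
  have "\<forall>i\<in>I. \<exists>R. \<forall>k t. R < \<bar>t\<bar> \<longrightarrow> H i k t = 0"
    using assms by (auto simp: bump_tower_def)
  then obtain R where R: "\<And>i k t. i \<in> I \<Longrightarrow> R i < \<bar>t\<bar> \<Longrightarrow> H i k t = 0"
    by metis
  show ?thesis
    unfolding bump_tower_def
  proof (intro conjI allI exI impI)
    fix k t
    show "((\<lambda>t. \<Sum>i\<in>I. H i k t) has_real_derivative (\<Sum>i\<in>I. H i (Suc k) t)) (at t)"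
      by (rule DERIV_sum) (use assms in \<open>auto simp: bump_tower_def\<close>)
  next
    fix k t assume t: "(\<Sum>i\<in>I. \<bar>R i\<bar>) < \<bar>t\<bar>"
    show "(\<Sum>i\<in>I. H i k t) = 0"
    proof (rule sum.neutral, intro ballI)
      fix i assume "i \<in> I"
      then have "\<bar>R i\<bar> \<le> (\<Sum>i\<in>I. \<bar>R i\<bar>)" using assms(1) by (intro member_le_sum) auto
      then show "H i k t = 0" using \<open>i \<in> I\<close> t by (intro R) auto
    qed
  qed
qed

lemma bump_tower_continuous:
  assumes "bump_tower H"
  shows "continuous_on A (H k)"
  by (rule DERIV_continuous_on[of A _ "H (Suc k)"])
     (use assms in \<open>auto simp: bump_tower_def intro: has_field_derivative_at_within\<close>)

lemma bump_tower_monomial_bounded: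
  assumes "bump_tower H"
  shows "\<exists>B. \<forall>t. \<bar>t ^ a * H k t\<bar> \<le> B"
proof -
  obtain R where R: "\<And>k t. R < \<bar>t\<bar> \<Longrightarrow> H k t = 0"
    using assms by (auto simp: bump_tower_def)
  have "compact ((\<lambda>t. t ^ a * H k t) ` {-\<bar>R\<bar>..\<bar>R\<bar>})"
    by (intro compact_continuous_image continuous_intros bump_tower_continuous assms) auto
  from compact_imp_bounded[OF this]
  obtain B where B: "\<forall>t\<in>{-\<bar>R\<bar>..\<bar>R\<bar>}. \<bar>t ^ a * H k t\<bar> \<le> B"
    by (auto simp: bounded_iff)
  have "\<bar>t ^ a * H k t\<bar> \<le> B" for t
  proof (cases "\<bar>t\<bar> \<le> \<bar>R\<bar>")
    case True
    then have "- \<bar>R\<bar> \<le> t" "t \<le> \<bar>R\<bar>" by linarith+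
    then show ?thesis using B by simp
  next
    case False
    then have "H k t = 0" by (intro R) auto
    moreover have "\<bar>0 ^ a * H k 0\<bar> \<le> B" by (rule B[rule_format]) auto
    then have "0 \<le> B" by linarith
    ultimately show ?thesis by simp
  qed
  then show ?thesis by blast
qed

section \<open>Tensor products as Schwartz functions\<close>

text \<open>\<open>\<alpha>\<close> records the order of differentiation in each coordinate, so that
  a partial derivative merely raises one entry.\<close>

definition tensor_fun :: "(nat \<Rightarrow> real \<Rightarrow> real) \<Rightarrow> ('n \<Rightarrow> nat) \<Rightarrow> real^'n::finite \<Rightarrow> complex" where
  "tensor_fun H \<alpha> x = complex_of_real (\<Prod>i\<in>UNIV. H (\<alpha> i) (x $ i))"

lemma tensor_fun_has_derivative:
  assumes "bump_tower H"
  shows "(tensor_fun H \<alpha> has_derivative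
    (\<lambda>v. complex_of_real (\<Sum>i\<in>UNIV. v $ i * H (Suc (\<alpha> i)) (x $ i) * (\<Prod>j\<in>UNIV - {i}. H (\<alpha> j) (x $ j))))) (at x)"
proof -
  have H: "(H k has_real_derivative H (Suc k) t) (at t)" for k t
    using assms by (auto simp: bump_tower_def)
  have 1: "((\<lambda>x. H (\<alpha> i) (x $ i)) has_derivative (\<lambda>v. v $ i * H (Suc (\<alpha> i)) (x $ i))) (at x)" for i
  proof -
    have "((\<lambda>x::real^'a. x $ i) has_derivative (\<lambda>v. v $ i)) (at x)"
      by (rule bounded_linear.has_derivative[OF bounded_linear_vec_nth has_derivative_ident])
    from has_derivative_compose[OF this H[unfolded has_field_derivative_def, of "\<alpha> i" "x $ i"]]
    show ?thesis by (simp add: mult.commute)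
  qed
  show ?thesis
    unfolding tensor_fun_def
    by (rule bounded_linear.has_derivative[OF bounded_linear_of_real])
       (rule has_derivative_prod[OF 1])
qed

lemma partial_deriv_tensor_fun:
  assumes "bump_tower H"
  shows "partial_deriv i (tensor_fun H \<alpha>) = tensor_fun H (\<alpha>(i := Suc (\<alpha> i)))"
proof
  fix x :: "real^'a"
  have "partial_deriv i (tensor_fun H \<alpha>) x = complex_of_real
     (\<Sum>j\<in>UNIV. axis i 1 $ j * H (Suc (\<alpha> j)) (x $ j) * (\<Prod>k\<in>UNIV - {j}. H (\<alpha> k) (x $ k)))"
    unfolding partial_deriv_def
    by (subst frechet_derivative_at[OF tensor_fun_has_derivative[OF assms], symmetric]) simp
  also have "(\<Sum>j\<in>UNIV. axis i 1 $ j * H (Suc (\<alpha> j)) (x $ j) * (\<Prod>k\<in>UNIV - {j}. H (\<alpha> k) (x $ k)))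
      = (\<Sum>j\<in>{i}. axis i 1 $ j * H (Suc (\<alpha> j)) (x $ j) * (\<Prod>k\<in>UNIV - {j}. H (\<alpha> k) (x $ k)))"
    by (rule sum.mono_neutral_right) (auto simp: axis_def)
  also have "\<dots> = H (Suc (\<alpha> i)) (x $ i) * (\<Prod>k\<in>UNIV - {i}. H (\<alpha> k) (x $ k))"
    by (simp add: axis_def)
  also have "\<dots> = (\<Prod>k\<in>UNIV. H ((\<alpha>(i := Suc (\<alpha> i))) k) (x $ k))"
    by (subst prod.remove[of _ i]) (auto intro!: prod.cong)
  finally show "partial_deriv i (tensor_fun H \<alpha>) x = tensor_fun H (\<alpha>(i := Suc (\<alpha> i))) x"
    unfolding tensor_fun_def[of H "\<alpha>(i := Suc (\<alpha> i))"] .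
qed

lemma iter_partial_tensor_fun:
  assumes "bump_tower H"
  shows "\<exists>\<beta>. iter_partial is (tensor_fun H \<alpha>) = tensor_fun H \<beta>"
proof (induction "is")
  case Nil
  then show ?case by (auto simp: iter_partial_def)
next
  case (Cons i "is")
  then obtain \<beta> where "iter_partial is (tensor_fun H \<alpha>) = tensor_fun H \<beta>" by blast
  then have "iter_partial (i # is) (tensor_fun H \<alpha>) = tensor_fun H (\<beta>(i := Suc (\<beta> i)))"
    using partial_deriv_tensor_fun[OF assms] by (simp add: iter_partial_def)
  then show ?case by blast
qed

text \<open>The monomial weight factors over the coordinates as the function does, so each seminorm
  is bounded by a product of one-variable bounds, which exist by compact support.\<close>

lemma tensor_fun_schwartz:
  assumes "bump_tower H"
  shows "tensor_fun H \<alpha> \<in> schwartz_space"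
  unfolding schwartz_space_def smooth_fun_def mem_Collect_eq
proof (intro conjI allI)
  fix "is" x
  obtain \<beta> where \<beta>: "iter_partial is (tensor_fun H \<alpha>) = tensor_fun H \<beta>"
    using iter_partial_tensor_fun[OF assms, of "is" \<alpha>] by (elim exE)
  show "iter_partial is (tensor_fun H \<alpha>) differentiable at x"
    unfolding \<beta> by (rule differentiableI[OF tensor_fun_has_derivative[OF assms]])
next
  fix a :: "'a \<Rightarrow> nat" and "is"
  obtain \<beta> where \<beta>: "iter_partial is (tensor_fun H \<alpha>) = tensor_fun H \<beta>"
    using iter_partial_tensor_fun[OF assms, of "is" \<alpha>] by (elim exE)
  have "\<forall>i. \<exists>B. \<forall>t. \<bar>t ^ a i * H (\<beta> i) t\<bar> \<le> B"
    by (intro allI bump_tower_monomial_bounded[OF assms])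
  then obtain B where B: "\<And>i t. \<bar>t ^ a i * H (\<beta> i) t\<bar> \<le> B i" by metis
  have "norm (complex_of_real (\<Prod>i\<in>UNIV. (x $ i) ^ a i) * tensor_fun H \<beta> x) \<le> (\<Prod>i\<in>UNIV. B i)" for x
  proof -
    have "norm (complex_of_real (\<Prod>i\<in>UNIV. (x $ i) ^ a i) * tensor_fun H \<beta> x)
        = (\<Prod>i\<in>UNIV. \<bar>(x $ i) ^ a i * H (\<beta> i) (x $ i)\<bar>)"
      by (simp only: tensor_fun_def of_real_mult[symmetric] norm_of_real prod.distrib[symmetric] abs_prod)
    also have "\<dots> \<le> (\<Prod>i\<in>UNIV. B i)" by (rule prod_mono) (use B in auto)
    finally show ?thesis .
  qed
  then show "bounded (range (\<lambda>x. complex_of_real (\<Prod>i\<in>UNIV. (x $ i) ^ a i) * iter_partial is (tensor_fun H \<alpha>) x))"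
    unfolding \<beta> bounded_iff by blast
qed

section \<open>Sums of translated bumps\<close>

text \<open>The average of \<open>M\<close> bumps of width \<open>r\<close> starting at the
  multiples \<open>N * m\<close>, with \<open>k\<close> the order of differentiation. The argument
  is spelled as an affine map so that \<open>bump_tower_affine\<close> applies directly.\<close>

definition comb :: "nat \<Rightarrow> nat \<Rightarrow> real \<Rightarrow> nat \<Rightarrow> real \<Rightarrow> real" where
  "comb M N r k t =
     1 / real M * (\<Sum>m<M. (1 / r) ^ k * bump k (1 / r * t + - (real N * real m / r)))"

lemma comb_0: "comb M N r 0 t = (\<Sum>m<M. bump 0 ((t - real N * real m) / r)) / real M"
  by (simp add: comb_def diff_divide_distrib)

lemma bump_tower_comb: "r \<noteq> 0 \<Longrightarrow> bump_tower (comb M N r)"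
  unfolding comb_def
  by (intro bump_tower_cmult bump_tower_sum bump_tower_affine bump_tower_bump) auto

lemma comb_nonneg: "0 \<le> comb M N r 0 t"
  by (simp add: comb_0 sum_nonneg bump_nonneg)

lemma comb_support:
  assumes "comb M N r 0 t \<noteq> 0" "0 < r"
  shows "\<exists>m<M. real N * real m < t \<and> t < real N * real m + r"
proof -
  have "(\<Sum>m<M. bump 0 ((t - real N * real m) / r)) \<noteq> 0" using assms(1) by (auto simp: comb_0)
  then obtain m where "m \<in> {..<M}" "bump 0 ((t - real N * real m) / r) \<noteq> 0"
    by (rule sum.not_neutral_contains_not_neutral)
  then show ?thesis using assms(2)
    by (intro exI[of _ m]) (auto simp: bump_0 field_simps split: if_splits)
qed

text \<open>Since \<open>r \<le> 1 \<le> N\<close>, the supports are disjoint: at most one summand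
  is nonzero at any point, and it is at most 1.\<close>

lemma comb_le:
  assumes "0 < r" "r \<le> 1" "1 \<le> N"
  shows "comb M N r 0 t \<le> 1 / real M"
proof -
  have "(\<Sum>m<M. bump 0 ((t - real N * real m) / r)) \<le> 1"
  proof (cases "\<exists>m<M. bump 0 ((t - real N * real m) / r) \<noteq> 0")
    case False
    then have "(\<Sum>m<M. bump 0 ((t - real N * real m) / r)) = 0" by (intro sum.neutral) auto
    then show ?thesis by simp
  next
    case True
    then obtain m where m: "m < M" "bump 0 ((t - real N * real m) / r) \<noteq> 0" by blast
    have *: "0 < t - real N * real k \<and> t - real N * real k < r" if "bump 0 ((t - real N * real k) / r) \<noteq> 0" for k
      using that assms by (auto simp: bump_0 field_simps split: if_splits)
    have "bump 0 ((t - real N * real k) / r) = 0" if "k \<noteq> m" for k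
    proof (rule ccontr)
      assume k: "bump 0 ((t - real N * real k) / r) \<noteq> 0"
      have "\<bar>real N * real k - real N * real m\<bar> < 1"
        using *[OF k] *[OF m(2)] assms(2) by linarith
      moreover have "\<bar>real N * real k - real N * real m\<bar> = real N * \<bar>real k - real m\<bar>"
        by (simp add: abs_mult flip: right_diff_distrib)
      moreover have "1 \<le> \<bar>real k - real m\<bar>" using that by linarith
      ultimately show False
        using assms mult_mono[of 1 "real N" 1 "\<bar>real k - real m\<bar>"] by simp
    qed
    then have "(\<Sum>k<M. bump 0 ((t - real N * real k) / r)) = (\<Sum>k\<in>{m}. bump 0 ((t - real N * real k) / r))"
      using m by (intro sum.mono_neutral_right) auto
    then show ?thesis using bump_le_1 by simp
  qed
  then show ?thesis by (simp add: comb_0 divide_right_mono)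
qed

lemma borel_measurable_bump [measurable]: "bump k \<in> borel_measurable borel"
  by (intro borel_measurable_continuous_onI bump_tower_continuous bump_tower_bump)

lemma borel_measurable_comb [measurable]: "comb M N r k \<in> borel_measurable borel"
  unfolding comb_def by measurable

section \<open>Integrals of bumps and combs\<close>

definition bump_mass :: real where
  "bump_mass = enn2real (\<integral>\<^sup>+t. ennreal (bump 0 t) \<partial>lborel)"

lemma nn_integral_bump: "(\<integral>\<^sup>+t. ennreal (bump 0 t) \<partial>lborel) = ennreal bump_mass"
  and bump_mass_pos: "0 < bump_mass"
proof -
  have "(\<integral>\<^sup>+t. ennreal (bump 0 t) \<partial>lborel) \<le> (\<integral>\<^sup>+t. indicator {0..1::real} t \<partial>lborel)"
    by (intro nn_integral_mono) (auto simp: bump_0 indicator_def)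
  then have fin: "(\<integral>\<^sup>+t. ennreal (bump 0 t) \<partial>lborel) \<le> 1" by simp
  then show eq: "(\<integral>\<^sup>+t. ennreal (bump 0 t) \<partial>lborel) = ennreal bump_mass"
    unfolding bump_mass_def by (metis ennreal_enn2real ennreal_one_less_top order_le_less_trans)
  \<comment> \<open>On the middle half of the unit interval \<open>t * (1 - t)\<close> is at least
    1/16, so a rectangle of height \<open>exp (- 16)\<close> and length 1/2 fits under the
    bump.\<close>
  have "ennreal (exp (- 16) / 2) = (\<integral>\<^sup>+t. ennreal (exp (- 16)) * indicator {1/4..3/4::real} t \<partial>lborel)"
  proof -
    have "emeasure lborel {1/4..3/4::real} = ennreal (1 / 2)" by simp
    then show ?thesis
      by (subst nn_integral_cmult_indicator) (simp_all only: ennreal_mult'[symmetric] exp_ge_zero, simp_all)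
  qed
  also have "\<dots> \<le> (\<integral>\<^sup>+t. ennreal (bump 0 t) \<partial>lborel)"
  proof (intro nn_integral_mono)
    fix t :: real
    show "ennreal (exp (- 16)) * indicator {1/4..3/4} t \<le> ennreal (bump 0 t)"
    proof (cases "t \<in> {1/4..3/4}")
      case True
      then have "1/4 * (1/4) \<le> t * (1 - t)" by (intro mult_mono) auto
      then have "1 / (t * (1 - t)) \<le> 16" by (simp add: field_simps)
      then show ?thesis using True by (auto simp: bump_0 ennreal_leI)
    qed auto
  qed
  finally show "0 < bump_mass" unfolding eq
    by (metis ennreal_eq_0_iff exp_gt_zero half_gt_zero leD le_zero_eq not_le_imp_less)
qed

text \<open>Averaging preserves the mass, as each translate has integral
  \<open>r * bump_mass\<close>. Independence of \<open>M\<close> and \<open>N\<close> keeps the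
  later lower bound for the Fourier transform uniform.\<close>

lemma nn_integral_comb:
  assumes "0 < r" "0 < M"
  shows "(\<integral>\<^sup>+t. ennreal (comb M N r 0 t) \<partial>lborel) = ennreal (r * bump_mass)"
proof -
  have one: "(\<integral>\<^sup>+t. ennreal (bump 0 ((t - c) / r)) \<partial>lborel) = ennreal (r * bump_mass)" for c
    using assms
    by (subst nn_integral_real_affine[where c = r and t = c])
       (auto simp: nn_integral_bump ennreal_mult bump_mass_pos less_imp_le)
  have "(\<integral>\<^sup>+t. ennreal (comb M N r 0 t) \<partial>lborel)
      = (\<integral>\<^sup>+t. ennreal (1 / M) * (\<Sum>m<M. ennreal (bump 0 ((t - real N * real m) / r))) \<partial>lborel)"
    by (intro nn_integral_cong)
       (simp add: comb_0 bump_nonneg sum_ennreal sum_nonneg flip: ennreal_mult)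
  also have "\<dots> = ennreal (1 / M) * (\<Sum>m<M. \<integral>\<^sup>+t. ennreal (bump 0 ((t - real N * real m) / r)) \<partial>lborel)"
    by (simp add: nn_integral_cmult nn_integral_sum)
  also have "\<dots> = ennreal (1 / M) * (of_nat M * ennreal (r * bump_mass))"
    by (simp add: one)
  also have "\<dots> = ennreal (r * bump_mass)"
    using assms bump_mass_pos by (simp add: ennreal_of_nat_eq_real_of_nat flip: ennreal_mult)
  finally show ?thesis .
qed

text \<open>The comb is at most \<open>1 / M\<close> and lives on \<open>M\<close> intervals of
  length \<open>r \<le> 1\<close>. For \<open>p > 1\<close> the resulting bound tends to 0 as
  \<open>M\<close> grows, unlike the mass.\<close>

lemma nn_integral_comb_powr:
  assumes "0 < r" "r \<le> 1" "0 < M" "1 \<le> N" "0 < p"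
  shows "(\<integral>\<^sup>+t. ennreal (comb M N r 0 t powr p) \<partial>lborel) \<le> ennreal (real M powr (1 - p))"
proof -
  have "(\<integral>\<^sup>+t. ennreal (comb M N r 0 t powr p) \<partial>lborel)
      \<le> (\<integral>\<^sup>+t. ennreal ((1 / M) powr p) * (\<Sum>m<M. indicator {real N * real m..real N * real m + r} t) \<partial>lborel)"
  proof (intro nn_integral_mono)
    fix t
    show "ennreal (comb M N r 0 t powr p) \<le> ennreal ((1 / M) powr p) * (\<Sum>m<M. indicator {real N * real m..real N * real m + r} t)"
    proof (cases "comb M N r 0 t = 0")
      case False
      then obtain m where m: "m < M" "real N * real m < t" "t < real N * real m + r"
        using comb_support assms by blast
      have "(1 :: ennreal) = (\<Sum>k\<in>{m}. indicator {real N * real k..real N * real k + r} t)"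
        using m by simp
      also have "\<dots> \<le> (\<Sum>m<M. indicator {real N * real m..real N * real m + r} t)"
        using m by (intro sum_mono2) auto
      finally have 1: "1 \<le> (\<Sum>m<M. indicator {real N * real m..real N * real m + r} t :: ennreal)" .
      have "comb M N r 0 t powr p \<le> (1 / M) powr p"
        using assms by (intro powr_mono2 comb_le comb_nonneg) auto
      then show ?thesis using mult_mono[OF ennreal_leI 1] by fastforce
    qed simp
  qed
  also have "\<dots> = ennreal ((1 / M) powr p) * (\<Sum>m<M. ennreal r)"
    using assms by (simp add: nn_integral_cmult nn_integral_sum)
  also have "\<dots> = ennreal ((1 / M) powr p * (M * r))"
    using assms by (simp add: ennreal_of_nat_eq_real_of_nat flip: ennreal_mult)
  also have "\<dots> \<le> ennreal ((1 / M) powr p * (M * 1))"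
    using assms by (intro ennreal_leI mult_left_mono) auto
  also have "(1 / M) powr p * (M * 1) = real M powr (1 - p)"
    using assms by (simp add: powr_diff powr_divide)
  finally show ?thesis .
qed

section \<open>Product integrals and Fourier integrals without cancellation\<close>

lemma prod_Basis_vec:
  fixes x :: "real^'n::finite" and g :: "real \<Rightarrow> 'b::comm_monoid_mult"
  shows "(\<Prod>b\<in>Basis. g (x \<bullet> b)) = (\<Prod>i\<in>UNIV. g (x $ i))"
proof -
  have B: "(Basis :: (real^'n) set) = (\<lambda>i. axis i 1) ` UNIV" by (auto simp: Basis_vec_def)
  have "inj (\<lambda>i::'n. axis i (1::real))" by (auto simp: inj_on_def axis_eq_axis)
  then show ?thesis unfolding B by (subst prod.reindex) (auto simp: inner_axis)
qed

lemma nn_integral_prod_vec: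
  assumes [measurable]: "g \<in> borel_measurable borel" and "\<And>t. 0 \<le> g t"
  shows "(\<integral>\<^sup>+x. ennreal (\<Prod>i\<in>UNIV. g (x $ i)) \<partial>(lborel :: (real^'n::finite) measure))
    = (\<integral>\<^sup>+t. ennreal (g t) \<partial>lborel) ^ CARD('n)"
proof -
  have "(\<integral>\<^sup>+x. ennreal (\<Prod>i\<in>UNIV. g (x $ i)) \<partial>(lborel :: (real^'n) measure))
      = (\<integral>\<^sup>+x. (\<Prod>b\<in>Basis. ennreal (g (x \<bullet> b))) \<partial>(lborel :: (real^'n) measure))"
    using assms(2) by (intro nn_integral_cong) (simp add: prod_ennreal prod_Basis_vec[of g])
  also have "\<dots> = (\<integral>\<^sup>+t. ennreal (g t) \<partial>lborel) ^ DIM(real^'n)"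
    by (subst nn_integral_lborel_prod) auto
  finally show ?thesis by simp
qed

text \<open>Within 1/6 of an integer, the angle is within \<open>pi / 3\<close> of a multiple of
  \<open>2 * pi\<close>.\<close>

lemma cos_ge_half:
  assumes "\<bar>y - of_int k\<bar> \<le> 1 / 6"
  shows "1 / 2 \<le> cos (2 * pi * y)"
proof -
  have "2 * pi * y = 2 * pi * (y - of_int k) + of_int k * (2 * pi)" by (simp add: algebra_simps)
  then have "cos (2 * pi * y) = cos (2 * pi * (y - of_int k))"
    using cos.plus_of_int[of "2 * pi * (y - of_int k)" k] by simp
  also have "\<dots> = cos \<bar>2 * pi * (y - of_int k)\<bar>" by simp
  also have "\<dots> \<ge> cos (pi / 3)"
    using assms by (intro cos_monotone_0_pi_le) (auto simp: abs_mult)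
  finally show ?thesis by (simp add: cos_60)
qed

text \<open>Wherever \<open>g\<close> does not vanish, the phase is so close to a full turn that the
  real part of the integrand is at least \<open>g x / 2\<close>; integrating this pointwise bound
  suffices.\<close>

lemma fourier_lower_bound:
  fixes g :: "real^'n::finite \<Rightarrow> real"
  assumes [measurable]: "g \<in> borel_measurable borel" and nonneg: "\<And>x. 0 \<le> g x"
    and int: "(\<integral>\<^sup>+x. ennreal (g x) \<partial>lborel) = ennreal c" and "0 \<le> c"
    and phase: "\<And>x. g x \<noteq> 0 \<Longrightarrow> \<exists>k::int. \<bar>x \<bullet> \<xi> - of_int k\<bar> \<le> 1 / 6"
  shows "c / 2 \<le> norm (fourier (\<lambda>x. complex_of_real (g x)) \<xi>)"
proof -
  have g: "integrable lborel g"
    by (rule integrableI_nonneg) (use nonneg int in auto)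
  have "(LINT x|lborel. g x) = c"
    using nonneg int \<open>0 \<le> c\<close> by (subst integral_eq_nn_integral) auto
  have gc: "integrable lborel (\<lambda>x. complex_of_real (g x) * cis (- (2 * pi * (x \<bullet> \<xi>))))"
    by (rule Bochner_Integration.integrable_bound[OF g]) (auto simp: norm_mult cis_conv_exp)
  have "c / 2 = (LINT x|lborel. g x * (1 / 2))"
    using \<open>(LINT x|lborel. g x) = c\<close> by simp
  also have "\<dots> \<le> (LINT x|lborel. Re (complex_of_real (g x) * cis (- (2 * pi * (x \<bullet> \<xi>)))))"
  proof (intro integral_mono)
    show "integrable lborel (\<lambda>x. g x * (1 / 2))" using g by simp
    show "integrable lborel (\<lambda>x. Re (complex_of_real (g x) * cis (- (2 * pi * (x \<bullet> \<xi>)))))"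
      by (rule integrable_Re[OF gc])
    fix x
    show "g x * (1 / 2) \<le> Re (complex_of_real (g x) * cis (- (2 * pi * (x \<bullet> \<xi>))))"
    proof (cases "g x = 0")
      case False
      then show ?thesis
        using phase[OF False] cos_ge_half[of "x \<bullet> \<xi>"] nonneg[of x]
          mult_left_mono[of "1/2" "cos (2 * pi * (x \<bullet> \<xi>))" "g x"] by auto
    qed simp
  qed
  also have "\<dots> = Re (fourier (\<lambda>x. complex_of_real (g x)) \<xi>)"
    unfolding fourier_def by (rule integral_Re[OF gc])
  also have "\<dots> \<le> norm (fourier (\<lambda>x. complex_of_real (g x)) \<xi>)" by (rule complex_Re_le_cmod)
  finally show ?thesis .
qed

section \<open>Failure of restriction near lattices\<close>

lemma ennreal_inverse_antimono:
  fixes x y :: ennreal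
  assumes "x \<le> y"
  shows "inverse y \<le> inverse x"
proof (cases "x = 0 \<or> y = top")
  case False
  then obtain a b where "x = ennreal a" "0 < a" "y = ennreal b" "0 < b"
    using assms by (cases x; cases y) (auto simp: less_le top_unique)
  then show ?thesis using assms by (auto simp: inverse_ennreal intro!: ennreal_leI)
qed auto

lemma ennreal_powr_mono: "a \<le> b \<Longrightarrow> 0 \<le> r \<Longrightarrow> ennreal_powr a r \<le> ennreal_powr b r"
  by (cases a; cases b) (auto simp: ennreal_powr_def top_unique intro!: ennreal_leI powr_mono2)

lemma ennreal_powr_pos: "0 < a \<Longrightarrow> 0 < ennreal_powr a r"
  by (cases a) (auto simp: ennreal_powr_def)

text \<open>\<open>K\<close> is independent of \<open>g\<close>: it is \<open>b\<close> for
  \<open>q = \<infinity>\<close>, and otherwise the norm of \<open>b\<close> times the indicator of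
  \<open>E\<close>. In the latter case it is infinite if \<open>E\<close> has infinite
  measure.\<close>

lemma Lp_norm_lower_bound:
  fixes \<mu> :: "'a measure"
  assumes E: "E \<in> sets \<mu>" "0 < emeasure \<mu> E" and "0 < b" "1 \<le> q"
  obtains K where "0 < K" "\<And>g. (\<And>x. x \<in> E \<Longrightarrow> b \<le> norm (g x)) \<Longrightarrow> K \<le> Lp_norm \<mu> q g"
proof (cases "q = \<infinity>")
  case True
  show ?thesis
  proof (rule that[of "ennreal b"])
    fix g :: "'a \<Rightarrow> complex" assume g: "\<And>x. x \<in> E \<Longrightarrow> b \<le> norm (g x)"
    have "ennreal b \<le> esssup \<mu> (\<lambda>x. ennreal (norm (g x)))"
    proof (rule ccontr)
      assume "\<not> ennreal b \<le> esssup \<mu> (\<lambda>x. ennreal (norm (g x)))"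
      then have less: "esssup \<mu> (\<lambda>x. ennreal (norm (g x))) < ennreal b" by simp
      have "AE x in \<mu>. ennreal (norm (g x)) \<le> esssup \<mu> (\<lambda>x. ennreal (norm (g x)))"
        by (rule esssup_AE)
      \<comment> \<open>An essential supremum below \<open>b\<close> forces \<open>E\<close> to be a
        null set.\<close>
      then have "AE x in \<mu>. x \<notin> E"
      proof eventually_elim
        case (elim x)
        show ?case
        proof
          assume "x \<in> E"
          from order_trans[OF ennreal_leI[OF g[OF this]] elim] less show False by (meson leD)
        qed
      qed
      then have "emeasure \<mu> E = 0"
        using E(1) by (subst (asm) AE_iff_measurable[of E]) (auto dest: sets.sets_into_space)
      then show False using E by simp
    qed
    then show "ennreal b \<le> Lp_norm \<mu> q g" by (simp add: Lp_norm_def True)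
  qed (use \<open>0 < b\<close> in simp)
next
  case False
  define Q where "Q = enn2real q"
  have Q: "0 < Q" using \<open>1 \<le> q\<close> False
    by (auto simp: Q_def enn2real_positive_iff top.not_eq_extremum intro: less_le_trans[of 0 1])
  show ?thesis
  proof (rule that[of "ennreal_powr (ennreal (b powr Q) * emeasure \<mu> E) (1 / Q)"])
    show "0 < ennreal_powr (ennreal (b powr Q) * emeasure \<mu> E) (1 / Q)"
      using E \<open>0 < b\<close> by (intro ennreal_powr_pos) (simp add: ennreal_zero_less_mult_iff)
    fix g :: "'a \<Rightarrow> complex" assume g: "\<And>x. x \<in> E \<Longrightarrow> b \<le> norm (g x)"
    have "ennreal (b powr Q) * emeasure \<mu> E = (\<integral>\<^sup>+x. ennreal (b powr Q) * indicator E x \<partial>\<mu>)"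
      using E by (simp add: nn_integral_cmult_indicator)
    also have "\<dots> \<le> (\<integral>\<^sup>+x. ennreal (norm (g x) powr Q) \<partial>\<mu>)"
      using Q \<open>0 < b\<close> by (intro nn_integral_mono) (auto simp: indicator_def intro!: ennreal_leI powr_mono2 g)
    finally show "ennreal_powr (ennreal (b powr Q) * emeasure \<mu> E) (1 / Q) \<le> Lp_norm \<mu> q g"
      using Q False by (auto simp: Lp_norm_def intro!: ennreal_powr_mono simp flip: Q_def)
  qed
qed

text \<open>Write \<open>x $ i = N * m + y\<close> and \<open>\<xi> $ i = a / N + \<eta>\<close>.
  Then the product is the integer \<open>m * a\<close> plus the errors \<open>N * m * \<eta>\<close>
  and \<open>y * \<xi> $ i\<close>. Each error is at most \<open>1 / (12 * CARD('n))\<close>, so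
  summing over the coordinates gives 1/6.\<close>

lemma comb_phase:
  fixes x \<xi> :: "real^'n::finite"
  assumes r: "0 < r" "r \<le> 1 / (12 * real CARD('n))" and N: "0 < N" and small: "real N * real M * \<delta> \<le> 1 / (12 * real CARD('n))"
    and \<delta>: "0 \<le> \<delta>"
    and \<xi>: "\<And>i. 0 \<le> \<xi> $ i \<and> \<xi> $ i \<le> 1"
      "\<And>i. \<exists>a::nat. real a / real N \<le> \<xi> $ i \<and> \<xi> $ i \<le> real a / real N + \<delta>"
    and x: "\<And>i. comb M N r 0 (x $ i) \<noteq> 0"
  shows "\<exists>k::int. \<bar>x \<bullet> \<xi> - of_int k\<bar> \<le> 1 / 6"
proof -
  have "\<exists>m. \<forall>i. m i < M \<and> real N * real (m i) < x $ i \<and> x $ i < real N * real (m i) + r"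
    using comb_support[OF x r(1)] by (intro choice) auto
  then obtain m where m: "\<And>i. m i < M" "\<And>i. real N * real (m i) < x $ i" "\<And>i. x $ i < real N * real (m i) + r"
    by auto
  have "\<exists>a. \<forall>i. real (a i) / real N \<le> \<xi> $ i \<and> \<xi> $ i \<le> real (a i) / real N + \<delta>"
    using \<xi>(2) by (intro choice) auto
  then obtain a :: "'n \<Rightarrow> nat" where a: "\<And>i. real (a i) / real N \<le> \<xi> $ i" "\<And>i. \<xi> $ i \<le> real (a i) / real N + \<delta>"
    by auto
  have "\<bar>x $ i * \<xi> $ i - real (m i * a i)\<bar> \<le> 1 / (6 * real CARD('n))" for i
  proof -
    define y \<eta> where "y = x $ i - real N * real (m i)" and "\<eta> = \<xi> $ i - real (a i) / real N"
    have y: "0 \<le> y" "y \<le> r" and \<eta>: "0 \<le> \<eta>" "\<eta> \<le> \<delta>"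
      using m[of i] a[of i] by (auto simp: y_def \<eta>_def)
    have "x $ i * \<xi> $ i - real (m i * a i) = real N * real (m i) * \<eta> + y * \<xi> $ i"
      using N by (simp add: y_def \<eta>_def field_simps)
    moreover have "0 \<le> real N * real (m i) * \<eta>" "0 \<le> y * \<xi> $ i"
      using y \<eta> \<xi>(1)[of i] by auto
    moreover have "real N * real (m i) * \<eta> \<le> real N * real M * \<delta>"
      using m(1)[of i] \<eta> by (intro mult_mono) auto
    moreover have "y * \<xi> $ i \<le> r * 1"
      using y \<xi>(1)[of i] by (intro mult_mono) auto
    moreover have "1 / (6 * real CARD('n)) = 1 / (12 * real CARD('n)) + 1 / (12 * real CARD('n))" by simp
    ultimately show ?thesis using r small by linarith
  qed
  then have "(\<Sum>i\<in>UNIV. \<bar>x $ i * \<xi> $ i - real (m i * a i)\<bar>) \<le> (\<Sum>i\<in>(UNIV::'n set). 1 / (6 * real CARD('n)))"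
    by (intro sum_mono) auto
  then have "\<bar>\<Sum>i\<in>UNIV. x $ i * \<xi> $ i - real (m i * a i)\<bar> \<le> 1 / 6"
    by (intro order_trans[OF sum_abs]) simp
  then have "\<bar>x \<bullet> \<xi> - of_int (int (\<Sum>i\<in>UNIV. m i * a i))\<bar> \<le> 1 / 6"
    by (simp add: inner_vec_def sum_subtractf)
  then show ?thesis by blast
qed

text \<open>The function is a product of equal combs, one per coordinate. Its mass does not involve
  \<open>M\<close>, and \<open>comb_phase\<close> turns it into a lower bound for the transform; its
  \<open>L^p\<close> norm is at most \<open>M powr (1 - p)\<close> raised to the power
  \<open>CARD('n) / p\<close>.\<close>

lemma test_function:
  fixes E :: "(real^'n::finite) set" and p :: real
  assumes M: "0 < M" and N: "0 < N" and small: "real N * real M * \<delta> \<le> 1 / (12 * real CARD('n))" and \<delta>: "0 \<le> \<delta>"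
    and E: "\<And>\<xi> i. \<xi> \<in> E \<Longrightarrow> 0 \<le> \<xi> $ i \<and> \<xi> $ i \<le> 1"
      "\<And>\<xi> i. \<xi> \<in> E \<Longrightarrow> \<exists>a::nat. real a / real N \<le> \<xi> $ i \<and> \<xi> $ i \<le> real a / real N + \<delta>"
    and p: "1 < p"
  obtains f :: "real^'n \<Rightarrow> complex" where "f \<in> schwartz_space"
    "\<And>\<xi>. \<xi> \<in> E \<Longrightarrow> (bump_mass / (12 * real CARD('n))) ^ CARD('n) / 2 \<le> norm (fourier f \<xi>)"
    "Lp_norm lborel (ennreal p) f \<le> ennreal (real M powr - (real CARD('n) * (p - 1) / p))"
proof -
  \<comment> \<open>The largest width allowed by \<open>comb_phase\<close>; it does not depend on
    \<open>M\<close>.\<close>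
  define r where "r = 1 / (12 * real CARD('n))"
  have "1 \<le> real CARD('n)" by (simp add: Suc_le_eq)
  then have r: "0 < r" "r \<le> 1" unfolding r_def by (simp, subst divide_le_eq_1_pos) linarith+
  define h where "h = comb M N r 0"
  have h: "0 \<le> h t" for t by (simp add: h_def comb_nonneg)
  have h_meas [measurable]: "h \<in> borel_measurable borel" by (simp add: h_def)
  define g where "g x = (\<Prod>i\<in>UNIV. h (x $ i))" for x :: "real^'n"
  have g: "0 \<le> g x" for x by (simp add: g_def h prod_nonneg)
  have "(\<lambda>x::real^'n. h (x $ i)) \<in> borel_measurable borel" for i
    by (intro measurable_compose[OF _ h_meas] borel_measurable_continuous_onI continuous_intros)
  then have [measurable]: "g \<in> borel_measurable borel"
    unfolding g_def by (intro borel_measurable_prod) auto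
  define f where "f = (\<lambda>x. complex_of_real (g x))"
  have "f = tensor_fun (comb M N r) (\<lambda>_. 0)"
    by (auto simp: f_def g_def tensor_fun_def h_def)
  then have 1: "f \<in> schwartz_space"
    by (simp only:) (rule tensor_fun_schwartz, rule bump_tower_comb, use r in simp)
  have "(\<integral>\<^sup>+x. ennreal (g x) \<partial>lborel) = ennreal ((r * bump_mass) ^ CARD('n))"
    unfolding g_def using r bump_mass_pos
    by (subst nn_integral_prod_vec) (auto simp: h_def comb_nonneg nn_integral_comb M ennreal_power)
  then have 2: "(r * bump_mass) ^ CARD('n) / 2 \<le> norm (fourier f \<xi>)" if "\<xi> \<in> E" for \<xi>
    unfolding f_def
  proof (rule fourier_lower_bound[rotated 2])
    fix x assume "g x \<noteq> 0"
    then have "comb M N r 0 (x $ i) \<noteq> 0" for i by (auto simp: g_def h_def)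
    then show "\<exists>k::int. \<bar>x \<bullet> \<xi> - of_int k\<bar> \<le> 1 / 6"
      using comb_phase[of r N M \<delta> \<xi> x] r N small \<delta> E[OF that] by (auto simp: r_def)
  qed (use r bump_mass_pos g in auto)
  have "(\<integral>\<^sup>+x. ennreal (norm (f x) powr p) \<partial>lborel) = (\<integral>\<^sup>+x. ennreal (\<Prod>i\<in>UNIV. h (x $ i) powr p) \<partial>(lborel :: (real^'n) measure))"
  proof (intro nn_integral_cong)
    fix x :: "real^'n"
    have "norm (f x) = (\<Prod>i\<in>UNIV. h (x $ i))"
      using g[of x] by (simp add: f_def) (simp add: g_def)
    then show "ennreal (norm (f x) powr p) = ennreal (\<Prod>i\<in>UNIV. h (x $ i) powr p)"
      by (simp add: prod_powr_distrib h)
  qed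
  also have "\<dots> = (\<integral>\<^sup>+t. ennreal (h t powr p) \<partial>lborel) ^ CARD('n)"
    by (rule nn_integral_prod_vec) auto
  also have "\<dots> \<le> ennreal (real M powr (1 - p)) ^ CARD('n)"
    unfolding h_def using r M N p by (intro power_mono nn_integral_comb_powr) auto
  also have "\<dots> = ennreal (real M powr (real CARD('n) * (1 - p)))"
    by (simp add: ennreal_power powr_powr mult.commute flip: powr_realpow')
  finally have "ennreal_powr (\<integral>\<^sup>+x. ennreal (norm (f x) powr p) \<partial>lborel) (1 / p)
      \<le> ennreal_powr (ennreal (real M powr (real CARD('n) * (1 - p)))) (1 / p)"
    using p by (intro ennreal_powr_mono) auto
  also have "\<dots> = ennreal (real M powr - (real CARD('n) * (p - 1) / p))"
  proof -
    have "real CARD('n) * (1 - p) * (1 / p) = - (real CARD('n) * (p - 1) / p)"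
      using p by (simp add: field_simps)
    then show ?thesis by (simp add: ennreal_powr_def powr_powr)
  qed
  finally have 3: "Lp_norm lborel (ennreal p) f \<le> ennreal (real M powr - (real CARD('n) * (p - 1) / p))"
    using p by (simp add: Lp_norm_def)
  show ?thesis using that[OF 1 _ 3] 2 by (simp add: r_def)
qed

text \<open>A finite supremum is refuted by a single test function: the numerators stay above a
  fixed positive constant while the denominators are at most a negative power of
  \<open>M\<close>.\<close>

lemma restriction_unbounded:
  fixes E :: "(real^'n::finite) set" and \<mu> :: "(real^'n) measure" and p :: real
  assumes E: "E \<in> sets \<mu>" "0 < emeasure \<mu> E"
    and unit: "\<And>\<xi> i. \<xi> \<in> E \<Longrightarrow> 0 \<le> \<xi> $ i \<and> \<xi> $ i \<le> 1"
    and approx: "\<And>\<epsilon>. 0 < \<epsilon> \<Longrightarrow> \<exists>(N::nat) \<delta>. 0 < N \<and> 0 \<le> \<delta> \<and> real N * \<delta> \<le> \<epsilon> \<and>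
      (\<forall>\<xi>\<in>E. \<forall>i. \<exists>a::nat. real a / real N \<le> \<xi> $ i \<and> \<xi> $ i \<le> real a / real N + \<delta>)"
    and p: "1 < p" and q: "1 \<le> q"
  shows "(SUP f \<in> {f \<in> schwartz_space. f \<noteq> (\<lambda>x. 0)}.
          Lp_norm \<mu> q (fourier f) / Lp_norm lborel (ennreal p) f) = \<infinity>"
    (is "?S = \<infinity>")
proof (rule ccontr)
  assume "?S \<noteq> \<infinity>"
  then obtain B where B: "?S = ennreal B" "0 \<le> B" by (cases ?S) auto
  define b where "b = (bump_mass / (12 * real CARD('n))) ^ CARD('n) / 2"
  have b: "0 < b" using bump_mass_pos by (simp add: b_def)
  obtain K where K: "0 < K" "\<And>g. (\<And>x. x \<in> E \<Longrightarrow> b \<le> norm (g x)) \<Longrightarrow> K \<le> Lp_norm \<mu> q g"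
    using Lp_norm_lower_bound[OF E b q] by metis
  \<comment> \<open>\<open>K\<close> may be infinite; its minimum with 1 is a positive real.\<close>
  have "min K 1 < top" by (simp add: min_less_iff_disj)
  then obtain k where k: "min K 1 = ennreal k" "0 \<le> k" by (cases "min K 1") auto
  have k0: "0 < k" using k K(1) by (metis ennreal_less_zero_iff min_less_iff_conj zero_less_one)
  obtain \<xi>\<^sub>0 where \<xi>\<^sub>0: "\<xi>\<^sub>0 \<in> E" using E(2) by fastforce
  define s where "s = real CARD('n) * (p - 1) / p"
  have s: "0 < s" using p by (simp add: s_def)
  \<comment> \<open>Chosen to make \<open>k * M powr s\<close> at least
    \<open>B + 1\<close>.\<close>
  obtain M :: nat where M: "((B + 1) / k) powr (1 / s) < real M" using reals_Archimedean2 by blast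
  then have M0: "0 < M" using powr_ge_zero[of "(B + 1) / k" "1 / s"] by linarith
  \<comment> \<open>The factor \<open>M\<close> in this accuracy pays for translates by up to nearly
    \<open>N * M\<close>.\<close>
  have "0 < 1 / (12 * real CARD('n) * M)" using M0 by simp
  from approx[OF this] obtain N :: nat and \<delta> where N: "0 < N" "0 \<le> \<delta>" "real N * \<delta> \<le> 1 / (12 * real CARD('n) * M)"
    and a: "\<And>\<xi> i. \<xi> \<in> E \<Longrightarrow> \<exists>a::nat. real a / real N \<le> \<xi> $ i \<and> \<xi> $ i \<le> real a / real N + \<delta>"
    by auto
  have small: "real N * real M * \<delta> \<le> 1 / (12 * real CARD('n))"
    using N(3) M0 by (simp add: field_simps)
  obtain f :: "real^'n \<Rightarrow> complex" where f: "f \<in> schwartz_space" "\<And>\<xi>. \<xi> \<in> E \<Longrightarrow> b \<le> norm (fourier f \<xi>)"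
    "Lp_norm lborel (ennreal p) f \<le> ennreal (real M powr - s)"
    using test_function[OF M0 N(1) small N(2) unit a p] unfolding b_def s_def by blast
  \<comment> \<open>A transform bounded below at a point rules out the zero function; the point
    exists because \<open>E\<close> has positive measure.\<close>
  have "f \<noteq> (\<lambda>x. 0)" using f(2)[OF \<xi>\<^sub>0] b by (auto simp: fourier_def)
  then have le: "Lp_norm \<mu> q (fourier f) / Lp_norm lborel (ennreal p) f \<le> ennreal B"
    unfolding B(1)[symmetric] using f(1) by (intro SUP_upper) auto
  have "B + 1 = (((B + 1) / k) powr (1 / s)) powr s * k"
    using k0 s B(2) by (simp add: powr_powr)
  also have "\<dots> \<le> real M powr s * k"
    using M s k0 by (intro mult_right_mono powr_mono2) auto
  finally have "ennreal (B + 1) \<le> ennreal (k / real M powr - s)"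
    by (intro ennreal_leI) (simp add: powr_minus divide_inverse mult.commute)
  also have "\<dots> = ennreal k / ennreal (real M powr - s)"
    using M0 k0 by (simp add: divide_ennreal)
  also have "\<dots> \<le> Lp_norm \<mu> q (fourier f) / Lp_norm lborel (ennreal p) f"
    unfolding divide_ennreal_def
  proof (intro mult_mono ennreal_inverse_antimono f(3))
    show "ennreal k \<le> Lp_norm \<mu> q (fourier f)"
    proof (rule order_trans)
      show "ennreal k \<le> K" unfolding k(1)[symmetric] by (rule min.cobounded1)
      show "K \<le> Lp_norm \<mu> q (fourier f)" by (rule K(2)[OF f(2)])
    qed
  qed auto
  also note le
  finally show False using B(2) by simp
qed

section \<open>A Cantor set with long gaps in the digits\<close>

text \<open>The squared logarithm is sublinear, so the skipped places have density zero, yet its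
  jumps at powers of two are unbounded, which gives the long gaps.\<close>

definition digit_pos :: "nat \<Rightarrow> nat" where
  "digit_pos m = m + (floor_log m)\<^sup>2"

lemma digit_pos_0 [simp]: "digit_pos 0 = 0"
  by (simp add: digit_pos_def)

lemma digit_pos_Suc: "digit_pos m + 1 \<le> digit_pos (Suc m)"
  by (simp add: digit_pos_def floor_log_le_iff power_mono)

text \<open>At \<open>Suc m = 2 ^ Suc l\<close> the logarithm rises from at most \<open>l\<close> to
  \<open>l + 1\<close>, so its square grows by at least \<open>2 * l + 1\<close>.\<close>

lemma digit_pos_gap: "\<exists>m. digit_pos m + l \<le> digit_pos (Suc m)"
proof -
  define k where "k = Suc l"
  define m where "m = (2::nat) ^ k - 1"
  have "(2::nat) ^ 1 \<le> 2 ^ k" by (intro power_increasing) (auto simp: k_def)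
  then have m: "Suc m = 2 ^ k" "0 < m" by (auto simp: m_def)
  have "floor_log m \<le> l"
  proof (rule ccontr)
    assume "\<not> floor_log m \<le> l"
    then have "(2::nat) ^ k \<le> 2 ^ floor_log m" by (intro power_increasing) (auto simp: k_def)
    also have "\<dots> \<le> m" using floor_log_exp2_le m(2) by blast
    finally show False using m(1) by simp
  qed
  then have "(floor_log m)\<^sup>2 \<le> l\<^sup>2" by (simp add: power_mono)
  moreover have "l\<^sup>2 + l \<le> k\<^sup>2" by (simp add: k_def power2_eq_square)
  ultimately have "digit_pos m + l \<le> digit_pos (Suc m)"
    unfolding digit_pos_def m(1) floor_log_power using m(1) by linarith
  then show ?thesis by blast
qed

text \<open>For large \<open>L = floor_log m\<close> one has
  \<open>L\<^sup>2 \<le> \<epsilon> * 2 ^ L \<le> \<epsilon> * m\<close>; below the threshold the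
  square is absorbed in \<open>B\<close>. A slope arbitrarily close to 1 is what full dimension
  rests on.\<close>

lemma digit_pos_sublinear:
  assumes "0 < \<epsilon>"
  obtains B where "\<And>m. real (digit_pos m) \<le> (1 + \<epsilon>) * real m + B"
proof -
  have "(\<lambda>L::nat. (real L)\<^sup>2 / 2 ^ L) \<longlonglongrightarrow> 0" by real_asymp
  from order_tendstoD(2)[OF this assms] obtain L0 where L0: "\<And>L. L0 \<le> L \<Longrightarrow> (real L)\<^sup>2 / 2 ^ L < \<epsilon>"
    by (auto simp: eventually_sequentially)
  have "real (digit_pos m) \<le> (1 + \<epsilon>) * real m + (real L0)\<^sup>2" for m
  proof (cases "L0 \<le> floor_log m \<and> 0 < m")
    case True
    then have "(real (floor_log m))\<^sup>2 \<le> \<epsilon> * 2 ^ floor_log m"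
      using L0[of "floor_log m"] by (simp add: field_simps)
    also have "\<dots> \<le> \<epsilon> * real m"
    proof (intro mult_left_mono)
      have "2 ^ floor_log m \<le> m" using floor_log_exp2_le True by blast
      then show "2 ^ floor_log m \<le> real m" by (metis of_nat_le_iff of_nat_numeral of_nat_power)
    qed (use assms in simp)
    finally show ?thesis by (simp add: digit_pos_def algebra_simps add_increasing2)
  next
    case False
    then have "(real (floor_log m))\<^sup>2 \<le> (real L0)\<^sup>2" by (intro power_mono) auto
    moreover have "0 \<le> \<epsilon> * real m" using assms by simp
    moreover have "real (digit_pos m) = real m + (real (floor_log m))\<^sup>2" by (simp add: digit_pos_def)
    moreover have "(1 + \<epsilon>) * real m = real m + \<epsilon> * real m" by (simp add: algebra_simps)
    ultimately show ?thesis by linarith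
  qed
  then show ?thesis using that by blast
qed

text \<open>For each \<open>m\<close>, some binary expansion has only zeros strictly between the
  places \<open>digit_pos m\<close> and \<open>digit_pos (Suc m)\<close>: the digits from the latter
  place on contribute at most \<open>2 / 2 ^ digit_pos (Suc m)\<close>. Intervals instead of digits
  sidestep ambiguous expansions and make closedness visible.\<close>

definition cantor_set :: "real set" where
  "cantor_set = {x \<in> {0..1}. \<forall>m. \<exists>a \<in> {0..2 ^ digit_pos m}.
     x \<in> {real a / 2 ^ digit_pos m .. real a / 2 ^ digit_pos m + 2 / 2 ^ digit_pos (Suc m)}}"

lemma closed_cantor_set: "closed cantor_set"
proof -
  have "cantor_set = {0..1} \<inter> (\<Inter>m. \<Union>a \<in> {0..2 ^ digit_pos m}.
     {real a / 2 ^ digit_pos m .. real a / 2 ^ digit_pos m + 2 / 2 ^ digit_pos (Suc m)})"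
    by (auto simp: cantor_set_def)
  \<comment> \<open>The range of \<open>a\<close> is finite, so each inner union is closed.\<close>
  moreover have "closed \<dots>"
    by (intro closed_Int closed_INT ballI closed_UN closed_atLeastAtMost) auto
  ultimately show ?thesis by simp
qed

text \<open>Moves the \<open>j\<close>-th binary digit after the point to place \<open>digit_pos j\<close>, for the first \<open>m\<close> digits.\<close>

primrec spread :: "nat \<Rightarrow> nat \<Rightarrow> nat" where
  "spread 0 k = k"
| "spread (Suc m) k = 2 ^ (digit_pos (Suc m) - digit_pos m) * spread m (k div 2) + k mod 2"

text \<open>The multiplier \<open>2 ^ (digit_pos (Suc m) - digit_pos m)\<close> is at least 2, so
  the appended binary digit cannot carry into the higher part.\<close>

lemma spread_strict_mono: "k < l \<Longrightarrow> spread m k < spread m l"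
proof (induction m arbitrary: k l)
  case (Suc m)
  define g where "g = (2::nat) ^ (digit_pos (Suc m) - digit_pos m)"
  have "(2::nat) ^ 1 \<le> g" unfolding g_def
    using digit_pos_Suc[of m] by (intro power_increasing) auto
  then have g: "2 \<le> g" by simp
  show ?case
  proof (cases "k div 2 = l div 2")
    case True
    then have "k mod 2 < l mod 2" using Suc.prems by (metis div_mult_mod_eq nat_add_left_cancel_less)
    then show ?thesis using True by simp
  next
    case False
    then have "k div 2 < l div 2" using Suc.prems by (meson div_le_mono le_neq_implies_less less_imp_le)
    then have "spread m (k div 2) + 1 \<le> spread m (l div 2)" using Suc.IH by (simp add: Suc_leI)
    then have "g * (spread m (k div 2) + 1) \<le> g * spread m (l div 2)" by (rule mult_le_mono2)
    moreover have "k mod 2 < g" using g by (metis less_le_trans mod_less_divisor zero_less_numeral)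
    ultimately have "g * spread m (k div 2) + k mod 2 < g * spread m (l div 2) + l mod 2"
      by (simp add: algebra_simps)
    then show ?thesis by (simp add: g_def)
  qed
qed simp

text \<open>For \<open>0 \<le> u < 1\<close> the floor of \<open>2 ^ m * u\<close> encodes the first
  \<open>m\<close> binary digits of \<open>u\<close>; after spreading, the last of them stands at
  place \<open>digit_pos m\<close>.\<close>

definition spread_trunc :: "nat \<Rightarrow> real \<Rightarrow> real" where
  "spread_trunc m u = real (spread m (nat \<lfloor>2 ^ m * u\<rfloor>)) / 2 ^ digit_pos m"

text \<open>One more digit of \<open>u\<close> puts 0 or 1 at place \<open>digit_pos (Suc m)\<close>
  and leaves the earlier digits alone.\<close>

lemma spread_trunc_Suc:
  assumes "0 \<le> u"
  shows "spread_trunc m u \<le> spread_trunc (Suc m) u"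
    and "spread_trunc (Suc m) u \<le> spread_trunc m u + 1 / 2 ^ digit_pos (Suc m)"
proof -
  define k where "k = nat \<lfloor>2 ^ Suc m * u\<rfloor>"
  have "\<lfloor>2 ^ m * u\<rfloor> = \<lfloor>2 ^ Suc m * u / real_of_int 2\<rfloor>" by simp
  also have "\<dots> = \<lfloor>2 ^ Suc m * u\<rfloor> div 2" by (rule floor_divide_real_eq_div) simp
  finally have k2: "nat \<lfloor>2 ^ m * u\<rfloor> = k div 2"
    using assms by (simp add: k_def nat_div_distrib)
  have le: "digit_pos m \<le> digit_pos (Suc m)" using digit_pos_Suc[of m] by simp
  then obtain g where g: "digit_pos (Suc m) = digit_pos m + g" using le_Suc_ex by blast
  have "spread_trunc (Suc m) u = spread_trunc m u + real (k mod 2) / 2 ^ digit_pos (Suc m)"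
    unfolding spread_trunc_def k2 k_def[symmetric] by (simp add: g power_add add_divide_distrib)
  moreover have "real (k mod 2) \<le> 1" by simp
  ultimately show "spread_trunc m u \<le> spread_trunc (Suc m) u"
    and "spread_trunc (Suc m) u \<le> spread_trunc m u + 1 / 2 ^ digit_pos (Suc m)"
    by (simp_all add: divide_right_mono)
qed

definition spread_real :: "real \<Rightarrow> real" where
  "spread_real u = (SUP m. spread_trunc m u)"

text \<open>The truncations increase, whereas the truncations plus one unit of their last place
  decrease, because that unit at least halves at every step; the supremum lies in between.\<close>

lemma
  assumes "0 \<le> u"
  shows spread_real_ge: "spread_trunc m u \<le> spread_real u"
    and spread_real_le: "spread_real u \<le> spread_trunc m u + 1 / 2 ^ digit_pos m"
proof -
  have inc: "incseq (\<lambda>m. spread_trunc m u)"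
    by (rule incseq_SucI) (rule spread_trunc_Suc[OF assms])
  have dec: "decseq (\<lambda>m. spread_trunc m u + 1 / 2 ^ digit_pos m)"
  proof (rule decseq_SucI)
    fix m
    have "(2::real) ^ (digit_pos m + 1) \<le> 2 ^ digit_pos (Suc m)"
      by (intro power_increasing digit_pos_Suc) simp
    then have "1 / 2 ^ digit_pos (Suc m) + 1 / 2 ^ digit_pos (Suc m) \<le> 1 / (2::real) ^ digit_pos m"
      by (simp add: field_simps)
    then show "spread_trunc (Suc m) u + 1 / 2 ^ digit_pos (Suc m) \<le> spread_trunc m u + 1 / 2 ^ digit_pos m"
      using spread_trunc_Suc(2)[OF assms, of m] by linarith
  qed
  have ub: "spread_trunc n u \<le> spread_trunc m u + 1 / 2 ^ digit_pos m" for n m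
  proof -
    have "spread_trunc n u \<le> spread_trunc (max m n) u" using inc by (simp add: incseq_def)
    also have "\<dots> \<le> spread_trunc (max m n) u + 1 / 2 ^ digit_pos (max m n)" by simp
    also have "\<dots> \<le> spread_trunc m u + 1 / 2 ^ digit_pos m"
      using dec unfolding decseq_def by (metis max.cobounded1)
    finally show ?thesis .
  qed
  show "spread_real u \<le> spread_trunc m u + 1 / 2 ^ digit_pos m"
    unfolding spread_real_def by (intro cSUP_least ub) auto
  show "spread_trunc m u \<le> spread_real u"
    unfolding spread_real_def by (intro cSUP_upper bdd_aboveI2[OF ub[where m = 0]]) auto
qed

text \<open>The witness is the truncation at level \<open>m\<close>. The tail consists of at most
  one unit from the next digit and one from all later digits, which explains the constant 2 in
  \<open>cantor_set\<close>.\<close>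

lemma spread_real_in_cantor_set:
  assumes "0 \<le> u" "u < 1"
  shows "spread_real u \<in> cantor_set"
proof -
  have "\<lfloor>u\<rfloor> = 0" using assms by linarith
  then have "spread_trunc 0 u = 0" by (simp add: spread_trunc_def)
  then have 01: "0 \<le> spread_real u" "spread_real u \<le> 1"
    using spread_real_ge[OF assms(1), of 0] spread_real_le[OF assms(1), of 0] by simp_all
  have "\<exists>a\<in>{0..2 ^ digit_pos m}. spread_real u \<in>
      {real a / 2 ^ digit_pos m .. real a / 2 ^ digit_pos m + 2 / 2 ^ digit_pos (Suc m)}" for m
  proof (rule bexI[of _ "spread m (nat \<lfloor>2 ^ m * u\<rfloor>)"])
    have "spread_real u \<le> spread_trunc m u + 1 / 2 ^ digit_pos (Suc m) + 1 / 2 ^ digit_pos (Suc m)"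
      using spread_real_le[OF assms(1), of "Suc m"] spread_trunc_Suc(2)[OF assms(1), of m] by linarith
    then show "spread_real u \<in> {real (spread m (nat \<lfloor>2 ^ m * u\<rfloor>)) / 2 ^ digit_pos m ..
        real (spread m (nat \<lfloor>2 ^ m * u\<rfloor>)) / 2 ^ digit_pos m + 2 / 2 ^ digit_pos (Suc m)}"
      using spread_real_ge[OF assms(1), of m] by (simp add: spread_trunc_def)
    have "spread_trunc m u \<le> 1" using spread_real_ge[OF assms(1), of m] 01 by linarith
    then have "real (spread m (nat \<lfloor>2 ^ m * u\<rfloor>)) \<le> real (2 ^ digit_pos m)"
      by (simp add: spread_trunc_def)
    then show "spread m (nat \<lfloor>2 ^ m * u\<rfloor>) \<in> {0..2 ^ digit_pos m}"
      by (simp only: of_nat_le_iff) simp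
  qed
  then show ?thesis using 01 by (auto simp: cantor_set_def)
qed

text \<open>If \<open>2 ^ m * v\<close> exceeds \<open>2 ^ m * u\<close> by at least 2, the truncations differ by at least two
  units of the last place, only one of which can be lost in the tail.\<close>

lemma spread_real_diff:
  assumes "0 \<le> u" "2 ^ m * u + 2 \<le> 2 ^ m * v"
  shows "1 / 2 ^ digit_pos m \<le> spread_real v - spread_real u"
proof -
  have v: "0 \<le> v"
  proof (rule ccontr)
    assume "\<not> 0 \<le> v"
    then have "2 ^ m * v < 0" by (simp add: mult_pos_neg)
    moreover have "0 \<le> 2 ^ m * u" using assms(1) by simp
    ultimately show False using assms(2) by linarith
  qed
  define k l where "k = nat \<lfloor>2 ^ m * u\<rfloor>" and "l = nat \<lfloor>2 ^ m * v\<rfloor>"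
  have "\<lfloor>2 ^ m * u\<rfloor> + 2 \<le> \<lfloor>2 ^ m * v\<rfloor>" using assms(2) by linarith
  moreover have "0 \<le> \<lfloor>2 ^ m * u\<rfloor>" using assms(1) by simp
  ultimately have "k + 1 < l" unfolding k_def l_def by linarith
  then have "spread m k + 2 \<le> spread m l"
    using spread_strict_mono[of k "k + 1" m] spread_strict_mono[of "k + 1" l m] by linarith
  then have "real (spread m k) + 2 \<le> real (spread m l)" by linarith
  then have "spread_trunc m u + 2 / 2 ^ digit_pos m \<le> spread_trunc m v"
    unfolding spread_trunc_def by (simp add: k_def l_def divide_right_mono flip: add_divide_distrib)
  moreover have "2 / 2 ^ digit_pos m = 1 / 2 ^ digit_pos m + 1 / (2::real) ^ digit_pos m" by simp
  ultimately show ?thesis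
    using spread_real_ge[OF v, of m] spread_real_le[OF assms(1), of m] by linarith
qed

text \<open>Let \<open>m\<close> be the first scale at which \<open>u\<close> and \<open>v\<close>
  differ by at least two units. Then their distance is below \<open>4 / 2 ^ m\<close>, while the
  images are at least \<open>1 / 2 ^ digit_pos m\<close> apart, and \<open>digit_pos m\<close> is at
  most \<open>m / t + B\<close>.\<close>

lemma spread_real_inverse_Hoelder:
  assumes t: "0 < t" "t < 1"
  obtains A where "0 < A"
    "\<And>u v. 0 \<le> u \<Longrightarrow> u < 1 \<Longrightarrow> 0 \<le> v \<Longrightarrow> v < 1 \<Longrightarrow> \<bar>u - v\<bar> \<le> A * \<bar>spread_real u - spread_real v\<bar> powr t"
proof -
  have "0 < 1 / t - 1" using t by simp
  then obtain B where B: "\<And>m. real (digit_pos m) \<le> (1 + (1 / t - 1)) * real m + B"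
    using digit_pos_sublinear by blast
  \<comment> \<open>The 4 comes from the minimality of \<open>m\<close>, and
    \<open>2 powr (t * B)\<close> compensates for \<open>B\<close> after taking the power
    \<open>t\<close>.\<close>
  define A where "A = 4 * 2 powr (t * B)"
  have main: "v - u \<le> A * \<bar>spread_real u - spread_real v\<bar> powr t" if "0 \<le> u" "u < v" "v < 1" for u v
  proof -
    define P where "P m \<longleftrightarrow> 2 \<le> 2 ^ m * (v - u)" for m :: nat
    obtain n :: nat where "2 / (v - u) < 2 ^ n" using real_arch_pow[of 2] by auto
    then have Pn: "P n" using that by (simp add: P_def field_simps)
    define m where "m = (LEAST m. P m)"
    have Pm: "P m" unfolding m_def by (rule LeastI[of P, OF Pn])
    \<comment> \<open>Two points of the unit interval differ by less than 2, so the least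
      \<open>m\<close> has a predecessor, at which \<open>P\<close> fails.\<close>
    have "\<not> P 0" using that by (simp add: P_def)
    with Pm obtain m' where m': "m = Suc m'" by (cases m) auto
    then have "\<not> P m'" unfolding m_def by (metis lessI not_less_Least)
    then have less: "2 ^ m * (v - u) < 4" by (simp add: m' P_def mult.commute)
    have d: "1 / 2 ^ digit_pos m \<le> spread_real v - spread_real u"
      using Pm that by (intro spread_real_diff) (auto simp: P_def algebra_simps)
    have "(2::real) powr (- m - t * B) = (2 powr (- (m / t + B))) powr t"
    proof -
      have "- m - t * B = - (m / t + B) * t" using t by (simp add: field_simps)
      then show ?thesis by (simp add: powr_powr)
    qed
    also have "\<dots> \<le> (2 powr - real (digit_pos m)) powr t"
      using B[of m] t by (intro powr_mono2 powr_mono) auto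
    also have "\<dots> = (1 / 2 ^ digit_pos m) powr t"
      by (simp add: powr_minus powr_realpow divide_inverse)
    also have "\<dots> \<le> \<bar>spread_real u - spread_real v\<bar> powr t"
      using d t by (intro powr_mono2) auto
    finally have "A * 2 powr (- m - t * B) \<le> A * \<bar>spread_real u - spread_real v\<bar> powr t"
      by (intro mult_left_mono) (auto simp: A_def)
    moreover have "A * 2 powr (- m - t * B) = 4 / 2 ^ m"
      by (simp add: A_def powr_diff powr_minus powr_realpow divide_inverse)
    moreover have "v - u \<le> 4 / 2 ^ m" using less by (simp add: field_simps)
    ultimately show ?thesis by linarith
  qed
  show ?thesis
  proof (rule that[of A])
    show "0 < A" by (simp add: A_def)
    fix u v :: real assume "0 \<le> u" "u < 1" "0 \<le> v" "v < 1"
    then show "\<bar>u - v\<bar> \<le> A * \<bar>spread_real u - spread_real v\<bar> powr t"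
      using main[of u v] main[of v u] by (cases u v rule: linorder_cases) (auto simp: abs_minus_commute)
  qed
qed

section \<open>Hausdorff dimension of the cube of the Cantor set\<close>

lemma emeasure_cbox_vec_const:
  fixes u :: "real^'n::finite"
  assumes "0 \<le> w"
  shows "emeasure lborel (cbox (u - vec w) (u + vec w)) = ennreal ((2 * w) ^ CARD('n))"
proof -
  have b: "(vec w :: real^'n) \<bullet> b = w" if "b \<in> Basis" for b
    using that by (auto simp: Basis_vec_def inner_axis)
  have diff: "(u + vec w - (u - vec w)) \<bullet> b = 2 * w" if "b \<in> Basis" for b
    unfolding inner_diff_left inner_add_left b[OF that] by simp
  have "emeasure lborel (cbox (u - vec w) (u + vec w)) = (\<Prod>b\<in>(Basis :: (real^'n) set). (u + vec w - (u - vec w)) \<bullet> b)"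
    using assms by (subst emeasure_lborel_cbox_eq) (simp add: inner_diff_left inner_add_left b)
  also have "(\<Prod>b\<in>(Basis :: (real^'n) set). (u + vec w - (u - vec w)) \<bullet> b) = (\<Prod>b\<in>(Basis :: (real^'n) set). 2 * w)"
    by (intro prod.cong refl diff)
  finally show ?thesis by simp
qed

text \<open>With \<open>D\<close> the diameter of \<open>U\<close>, the preimage lies in a cube of
  half-side \<open>A * D powr t\<close> about any of its points. As \<open>D \<le> 1\<close> and
  \<open>s \<le> t * CARD('n)\<close>, the volume is controlled by \<open>D powr s\<close>. The cube
  replaces the preimage, whose measurability is unknown.\<close>

lemma preimage_in_cbox:
  fixes \<Psi> :: "real^'n::finite \<Rightarrow> 'a::metric_space" and Q :: "(real^'n) set" and A t s :: real
  assumes "0 < A" "0 < t" "0 \<le> s" "s \<le> t * CARD('n)"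
    and Hoelder: "\<And>u v i. u \<in> Q \<Longrightarrow> v \<in> Q \<Longrightarrow> \<bar>u $ i - v $ i\<bar> \<le> A * dist (\<Psi> u) (\<Psi> v) powr t"
    and U: "bounded U" "diameter U \<le> 1"
  obtains B where "B \<in> sets lborel" "{u \<in> Q. \<Psi> u \<in> U} \<subseteq> B"
    "emeasure lborel B \<le> ennreal ((2 * A) ^ CARD('n)) * diam_pow s U"
proof (cases "\<exists>u\<in>Q. \<Psi> u \<in> U")
  case False
  show ?thesis by (rule that[of "{}"]) (use False in auto)
next
  case True
  then obtain u where u: "u \<in> Q" "\<Psi> u \<in> U" by blast
  define D where "D = diameter U"
  have D: "0 \<le> D" "D \<le> 1" using U diameter_ge_0 by (auto simp: D_def)
  define w where "w = A * D powr t"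
  have w: "0 \<le> w" using \<open>0 < A\<close> by (simp add: w_def)
  have "v \<in> cbox (u - vec w) (u + vec w)" if v: "v \<in> Q" "\<Psi> v \<in> U" for v
  proof -
    have "\<bar>v $ i - u $ i\<bar> \<le> w" for i
    proof -
      have "dist (\<Psi> v) (\<Psi> u) \<le> D"
        unfolding D_def by (rule diameter_bounded_bound) (use U u v in auto)
      then have "A * dist (\<Psi> v) (\<Psi> u) powr t \<le> w"
        unfolding w_def using assms(1,2) by (intro mult_left_mono powr_mono2) auto
      then show ?thesis using Hoelder[OF v(1) u(1), of i] by linarith
    qed
    then have "u $ i - w \<le> v $ i \<and> v $ i \<le> u $ i + w" for i
      by (simp add: abs_le_iff algebra_simps)
    then show ?thesis by (simp add: mem_box_cart)
  qed
  then have sub: "{v \<in> Q. \<Psi> v \<in> U} \<subseteq> cbox (u - vec w) (u + vec w)" by blast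
  have pow_le: "ennreal (D powr (t * CARD('n))) \<le> diam_pow s U"
  proof -
    have ne: "U \<noteq> {}" using u by blast
    \<comment> \<open>At \<open>D = 0\<close> both powers are 0 by the convention for
      \<open>powr\<close>; otherwise a larger exponent gives a smaller power.\<close>
    have 1: "D powr (t * CARD('n)) \<le> D powr s"
      using D assms(4) by (cases "D = 0") (auto intro: powr_mono')
    have 2: "D powr s \<le> 1" using D \<open>0 \<le> s\<close> by (simp add: powr_le1)
    show ?thesis
    proof (cases "s = 0")
      case True
      have "ennreal (D powr (t * CARD('n))) \<le> ennreal 1"
        using 1 2 by (intro ennreal_leI) linarith
      then show ?thesis using ne True by (simp add: diam_pow_def)
    next
      case False
      then show ?thesis using ne 1 by (simp add: diam_pow_def D_def ennreal_leI)
    qed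
  qed
  have eq: "(2 * w) ^ CARD('n) = (2 * A) ^ CARD('n) * D powr (t * CARD('n))"
  proof -
    have "(D powr t) ^ CARD('n) = D powr (t * CARD('n))"
      by (simp add: powr_powr flip: powr_realpow')
    then show ?thesis by (simp add: w_def power_mult_distrib)
  qed
  have "ennreal ((2 * w) ^ CARD('n)) = ennreal ((2 * A) ^ CARD('n)) * ennreal (D powr (t * CARD('n)))"
    unfolding eq using \<open>0 < A\<close> by (intro ennreal_mult) auto
  also have "\<dots> \<le> ennreal ((2 * A) ^ CARD('n)) * diam_pow s U"
    by (intro mult_left_mono pow_le) simp
  finally have "ennreal ((2 * w) ^ CARD('n)) \<le> ennreal ((2 * A) ^ CARD('n)) * diam_pow s U" .
  then show ?thesis
    using that[of "cbox (u - vec w) (u + vec w)"] sub emeasure_cbox_vec_const[OF w, of u] by simp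
qed

text \<open>A mass distribution argument: a cover of \<open>E\<close> with too small a sum would
  pull back to a cover of \<open>Q\<close> by boxes of total volume below that of
  \<open>Q\<close>.\<close>

lemma hausdorff_measure_nonzero:
  fixes \<Psi> :: "real^'n::finite \<Rightarrow> 'a::metric_space" and Q :: "(real^'n) set" and A t s :: real
  assumes "0 < A" "0 < t" "0 \<le> s" "s \<le> t * CARD('n)"
    and Hoelder: "\<And>u v i. u \<in> Q \<Longrightarrow> v \<in> Q \<Longrightarrow> \<bar>u $ i - v $ i\<bar> \<le> A * dist (\<Psi> u) (\<Psi> v) powr t"
    and E: "\<Psi> ` Q \<subseteq> E" and Q: "Q \<in> sets lborel" "0 < emeasure lborel Q"
  shows "hausdorff_measure s E \<noteq> 0"
proof
  assume "hausdorff_measure s E = 0"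
  \<comment> \<open>Scale 1 suffices, since \<open>preimage_in_cbox\<close> asks only for diameters
    up to 1.\<close>
  moreover have "hausdorff_premeasure s 1 E \<le> hausdorff_measure s E"
    unfolding hausdorff_measure_def by (rule SUP_upper) simp
  ultimately have zero: "hausdorff_premeasure s 1 E = 0" by simp
  define c where "c = ennreal ((2 * A) ^ CARD('n))"
  have c: "0 < c" "c \<noteq> top" using \<open>0 < A\<close> by (auto simp: c_def)
  have "0 < emeasure lborel Q / c" using c Q by (simp add: ennreal_zero_less_divide less_top)
  then have "hausdorff_premeasure s 1 E < emeasure lborel Q / c" by (simp add: zero)
  then obtain U :: "nat \<Rightarrow> 'a set" where U: "E \<subseteq> (\<Union>i. U i)"
      "\<And>i. bounded (U i)" "\<And>i. diameter (U i) \<le> 1"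
      and less: "(\<Sum>i. diam_pow s (U i)) < emeasure lborel Q / c"
    unfolding hausdorff_premeasure_def Inf_less_iff by auto
  have "\<exists>B. B \<in> sets lborel \<and> {u \<in> Q. \<Psi> u \<in> U i} \<subseteq> B \<and> emeasure lborel B \<le> c * diam_pow s (U i)" for i
    unfolding c_def by (rule preimage_in_cbox[OF assms(1-4) Hoelder U(2)[of i] U(3)[of i]]) auto
  then have "\<exists>B. \<forall>i. B i \<in> sets lborel \<and> {u \<in> Q. \<Psi> u \<in> U i} \<subseteq> B i \<and>
      emeasure lborel (B i) \<le> c * diam_pow s (U i)"
    by (intro choice allI)
  then obtain B where B: "\<And>i. B i \<in> sets lborel" "\<And>i. {u \<in> Q. \<Psi> u \<in> U i} \<subseteq> B i"
      "\<And>i. emeasure lborel (B i) \<le> c * diam_pow s (U i)"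
    by blast
  have "Q \<subseteq> (\<Union>i. B i)"
  proof
    fix u assume "u \<in> Q"
    then obtain i where "\<Psi> u \<in> U i" using E U(1) by blast
    then show "u \<in> (\<Union>i. B i)" using B(2)[of i] \<open>u \<in> Q\<close> by blast
  qed
  then have "emeasure lborel Q \<le> emeasure lborel (\<Union>i. B i)"
    using B(1) by (intro emeasure_mono) auto
  also have "\<dots> \<le> (\<Sum>i. emeasure lborel (B i))"
    using B(1) by (intro emeasure_subadditive_countably) auto
  also have "\<dots> \<le> (\<Sum>i. c * diam_pow s (U i))"
    by (intro suminf_le B(3)) auto
  also have "\<dots> = c * (\<Sum>i. diam_pow s (U i))" by (rule ennreal_suminf_cmult)
  also have "\<dots> < c * (emeasure lborel Q / c)"
    using less c by (intro ennreal_mult_strict_left_mono) (auto simp: less_top)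
  also have "\<dots> = emeasure lborel Q"
    using c by (subst ennreal_times_divide, subst mult.commute) (simp add: ennreal_mult_divide_eq)
  finally show False by simp
qed

section \<open>Upper bound for the dimension by grids of cubes\<close>

text \<open>The finite cover is padded to a sequence with empty sets, which cost nothing since
  \<open>diam_pow\<close> is 0 on them for every exponent.\<close>

lemma hausdorff_premeasure_le_finite_cover:
  assumes "finite I" "E \<subseteq> (\<Union>i\<in>I. U i)" "\<And>i. i \<in> I \<Longrightarrow> bounded (U i)"
    "\<And>i. i \<in> I \<Longrightarrow> diameter (U i) \<le> \<delta>" "0 \<le> \<delta>"
  shows "hausdorff_premeasure s \<delta> E \<le> (\<Sum>i\<in>I. diam_pow s (U i))"
proof -
  obtain e where e: "bij_betw e {0..<card I} I" using ex_bij_betw_nat_finite[OF assms(1)] by blast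
  define V where "V n = (if n < card I then U (e n) else {})" for n
  have eI: "e n \<in> I" if "n < card I" for n using e that by (auto simp: bij_betw_def)
  have "(\<Sum>n. diam_pow s (V n)) = (\<Sum>n\<in>{0..<card I}. diam_pow s (V n))"
    by (rule suminf_finite) (auto simp: V_def diam_pow_def)
  also have "\<dots> = (\<Sum>n\<in>{0..<card I}. diam_pow s (U (e n)))"
    by (rule sum.cong) (auto simp: V_def)
  also have "\<dots> = (\<Sum>i\<in>I. diam_pow s (U i))"
    by (rule sum.reindex_bij_betw[OF e])
  finally have sum: "(\<Sum>n. diam_pow s (V n)) = (\<Sum>i\<in>I. diam_pow s (U i))" .
  have "E \<subseteq> (\<Union>n. V n)"
  proof
    fix x assume "x \<in> E"
    then obtain i where "i \<in> I" "x \<in> U i" using assms(2) by blast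
    moreover have "i \<in> e ` {0..<card I}"
      using e \<open>i \<in> I\<close> by (simp add: bij_betw_def)
    then obtain n where "n < card I" "i = e n" by auto
    ultimately show "x \<in> (\<Union>n. V n)" by (auto simp: V_def)
  qed
  then show ?thesis
    unfolding hausdorff_premeasure_def sum[symmetric]
    by (intro Inf_lower CollectI exI[of _ V]) (auto simp: V_def eI assms)
qed

text \<open>The cover is the grid of cubes of side \<open>1 / N\<close>. Indices run up to and
  including \<open>N\<close> to catch coordinates equal to 1, and the diameter is estimated through
  the sum of the coordinate differences.\<close>

lemma hausdorff_premeasure_unit_cube:
  fixes E :: "(real^'n::finite) set"
  assumes E: "\<And>x i. x \<in> E \<Longrightarrow> 0 \<le> x $ i \<and> x $ i \<le> 1"
    and N: "0 < N" "CARD('n) / real N \<le> \<delta>" and s: "0 < s"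
  shows "hausdorff_premeasure s \<delta> E \<le> ennreal (real (Suc N) ^ CARD('n) * (CARD('n) / real N) powr s)"
proof -
  define I where "I = (UNIV :: 'n set) \<rightarrow>\<^sub>E {..N}"
  define U where "U k = {x :: real^'n. \<forall>i. real (k i) / N \<le> x $ i \<and> x $ i \<le> (real (k i) + 1) / N}" for k :: "'n \<Rightarrow> nat"
  have fin: "finite I" and card: "card I = Suc N ^ CARD('n)"
    by (auto simp: I_def card_PiE intro!: finite_PiE)
  have dist: "dist x y \<le> CARD('n) / real N" if "x \<in> U k" "y \<in> U k" for x y k
  proof -
    have "\<bar>(x - y) $ i\<bar> \<le> 1 / N" for i
    proof -
      have "real (k i) / N \<le> x $ i" "x $ i \<le> real (k i) / N + 1 / N"
        "real (k i) / N \<le> y $ i" "y $ i \<le> real (k i) / N + 1 / N"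
        using that by (auto simp: U_def add_divide_distrib)
      then show ?thesis unfolding vector_minus_component by linarith
    qed
    then have "(\<Sum>i\<in>UNIV. \<bar>(x - y) $ i\<bar>) \<le> (\<Sum>i\<in>(UNIV::'n set). 1 / N)" by (intro sum_mono)
    then show ?thesis using norm_le_l1_cart[of "x - y"] by (simp add: dist_norm)
  qed
  have diam: "diameter (U k) \<le> CARD('n) / real N" for k
    by (rule diameter_le) (use dist in \<open>auto simp: dist_norm\<close>)
  have bdd: "bounded (U k)" for k
    unfolding bounded_two_points using dist by blast
  have diam0: "0 \<le> diameter (U k)" for k by (rule diameter_ge_0[OF bdd])
  have "E \<subseteq> (\<Union>k\<in>I. U k)"
  proof
    fix x assume x: "x \<in> E"
    define k where "k i = nat \<lfloor>N * x $ i\<rfloor>" for i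
    have k: "real (k i) \<le> N * x $ i" "N * x $ i \<le> real (k i) + 1" "k i \<le> N" for i
    proof -
      have x01: "0 \<le> x $ i" "x $ i \<le> 1" using E[OF x] by auto
      then have 0: "0 \<le> N * x $ i" by simp
      then show k1: "real (k i) \<le> N * x $ i" by (simp add: k_def)
      show "N * x $ i \<le> real (k i) + 1" using 0 by (simp add: k_def)
      have "N * x $ i \<le> N" using x01 by (simp add: mult_left_le)
      with k1 show "k i \<le> N" by linarith
    qed
    then have "x \<in> U k" using N(1) by (auto simp: U_def field_simps)
    moreover have "k \<in> I" using k(3) by (auto simp: I_def)
    ultimately show "x \<in> (\<Union>k\<in>I. U k)" by blast
  qed
  then have "hausdorff_premeasure s \<delta> E \<le> (\<Sum>k\<in>I. diam_pow s (U k))"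
    using N(2) by (intro hausdorff_premeasure_le_finite_cover fin bdd order_trans[OF diam])
      (auto intro: order_trans[of _ "CARD('n) / real N"])
  also have "\<dots> \<le> (\<Sum>k\<in>I. ennreal ((CARD('n) / real N) powr s))"
    using s diam diam0 by (intro sum_mono) (auto simp: diam_pow_def intro!: ennreal_leI powr_mono2)
  also have "\<dots> = ennreal (real (Suc N) ^ CARD('n) * (CARD('n) / real N) powr s)"
    by (simp add: card ennreal_mult ennreal_of_nat_eq_real_of_nat)
  finally show ?thesis .
qed

text \<open>The cost of the grid cover is of order \<open>N powr (CARD('n) - s)\<close>, which tends
  to 0 as the grid is refined.\<close>

lemma hausdorff_measure_unit_cube_zero:
  fixes E :: "(real^'n::finite) set"
  assumes E: "\<And>x i. x \<in> E \<Longrightarrow> 0 \<le> x $ i \<and> x $ i \<le> 1" and s: "real CARD('n) < s"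
  shows "hausdorff_measure s E = 0"
proof -
  define d where "d = real CARD('n)"
  have d: "0 < d" "d < s" using s by (auto simp: d_def)
  have "hausdorff_premeasure s \<delta> E = 0" if "0 < \<delta>" for \<delta>
  proof -
    have "(\<lambda>N. real (Suc N) powr d * (d / real N) powr s) \<longlonglongrightarrow> 0"
      using d by real_asymp
    moreover have "real (Suc N) powr d = real (Suc N) ^ CARD('n)" for N
      by (simp add: d_def powr_realpow del: of_nat_Suc)
    ultimately have "(\<lambda>N. ennreal (real (Suc N) ^ CARD('n) * (d / real N) powr s)) \<longlonglongrightarrow> ennreal 0"
      by (intro tendsto_ennrealI) (simp del: of_nat_Suc)
    moreover have "\<forall>\<^sub>F N in sequentially.
        hausdorff_premeasure s \<delta> E \<le> ennreal (real (Suc N) ^ CARD('n) * (d / real N) powr s)"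
    proof -
      have "(\<lambda>N. d / real N) \<longlonglongrightarrow> 0" by real_asymp
      from order_tendstoD(2)[OF this \<open>0 < \<delta>\<close>] eventually_gt_at_top[of 0]
      show ?thesis
      proof eventually_elim
        case (elim N)
        then show ?case using hausdorff_premeasure_unit_cube[of E N \<delta> s] E d by (simp add: d_def)
      qed
    qed
    ultimately have "hausdorff_premeasure s \<delta> E \<le> ennreal 0"
      by (intro tendsto_lowerbound) auto
    then show ?thesis by simp
  qed
  then show ?thesis by (auto simp: hausdorff_measure_def intro!: antisym SUP_least)
qed

section \<open>The set of the theorem: compactness, dimension and closeness to lattices\<close>

definition cantor_cube :: "(real^'n::finite) set" where
  "cantor_cube = {x. \<forall>i. x $ i \<in> cantor_set}"

lemma cantor_cube_unit: "x \<in> cantor_cube \<Longrightarrow> 0 \<le> x $ i \<and> x $ i \<le> 1"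
  by (auto simp: cantor_cube_def cantor_set_def)

lemma compact_cantor_cube: "compact (cantor_cube :: (real^'n::finite) set)"
proof -
  have "closed {x :: real^'n. x $ i \<in> cantor_set}" for i
    using closed_vimage[OF closed_cantor_set, of "\<lambda>x::real^'n. x $ i"]
    by (simp add: vimage_def continuous_intros)
  then have "closed (cantor_cube :: (real^'n) set)"
    unfolding cantor_cube_def by (intro closed_Collect_all)
  moreover have "cantor_cube \<subseteq> cbox (0 :: real^'n) 1"
    by (auto simp: mem_box_cart cantor_cube_unit)
  then have "bounded (cantor_cube :: (real^'n) set)" by (rule bounded_subset[OF bounded_cbox])
  ultimately show ?thesis by (simp add: compact_eq_bounded_closed)
qed

text \<open>Below the dimension of the space, spreading the digits in every coordinate maps the open
  unit cube into the set with a Hoelder inverse of suitable exponent \<open>t < 1\<close>; above it,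
  lying in the unit cube is enough.\<close>

lemma hausdorff_dim_cantor_cube:
  "hausdorff_dim (cantor_cube :: (real^'n::finite) set) = of_nat CARD('n)"
proof -
  let ?E = "cantor_cube :: (real^'n) set"
  have d: "0 < real CARD('n)" by simp
  have nat_eq: "(of_nat CARD('n) :: ennreal) = ennreal (real CARD('n))"
    by (simp add: ennreal_of_nat_eq_real_of_nat)
  have nonzero: "hausdorff_measure s ?E \<noteq> 0" if s: "0 \<le> s" "s < real CARD('n)" for s
  proof -
    \<comment> \<open>The maximum with 1/2 keeps \<open>t\<close> positive when
      \<open>s = 0\<close>.\<close>
    define t where "t = max (s / real CARD('n)) (1 / 2)"
    have t: "0 < t" "t < 1" "s \<le> t * real CARD('n)"
      using s d by (auto simp: t_def max_def field_simps)
    obtain A where A: "0 < A" "\<And>u v. 0 \<le> u \<Longrightarrow> u < 1 \<Longrightarrow> 0 \<le> v \<Longrightarrow> v < 1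
        \<Longrightarrow> \<bar>u - v\<bar> \<le> A * \<bar>spread_real u - spread_real v\<bar> powr t"
      using spread_real_inverse_Hoelder[OF t(1,2)] by blast
    define \<Psi> :: "real^'n \<Rightarrow> real^'n" where "\<Psi> u = (\<chi> i. spread_real (u $ i))" for u
    define Q :: "(real^'n) set" where "Q = box 0 1"
    have Q: "0 \<le> u $ i" "u $ i < 1" if "u \<in> Q" for u i
      using that by (auto simp: Q_def mem_box_cart less_imp_le)
    show ?thesis
    proof (rule hausdorff_measure_nonzero[OF A(1) t(1) s(1) t(3)])
      fix u v i assume uv: "u \<in> Q" "v \<in> Q"
      have "\<bar>spread_real (u $ i) - spread_real (v $ i)\<bar> \<le> dist (\<Psi> u) (\<Psi> v)"
        using component_le_norm_cart[of "\<Psi> u - \<Psi> v" i] by (simp add: dist_norm \<Psi>_def)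
      then have "A * \<bar>spread_real (u $ i) - spread_real (v $ i)\<bar> powr t \<le> A * dist (\<Psi> u) (\<Psi> v) powr t"
        using A(1) t by (intro mult_left_mono powr_mono2) auto
      then show "\<bar>u $ i - v $ i\<bar> \<le> A * dist (\<Psi> u) (\<Psi> v) powr t"
        using A(2)[of "u $ i" "v $ i"] Q[OF uv(1)] Q[OF uv(2)] by (meson order_trans)
    next
      show "\<Psi> ` Q \<subseteq> ?E"
        using Q by (auto simp: \<Psi>_def cantor_cube_def intro!: spread_real_in_cantor_set)
      show "Q \<in> sets lborel" by (simp add: Q_def)
      have "emeasure lborel Q = (\<Prod>b\<in>Basis. (1 - 0 :: real^'n) \<bullet> b)"
        unfolding Q_def by (subst emeasure_lborel_box_eq) (auto simp: Basis_vec_def inner_axis)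
      also have "\<dots> = 1" by (simp add: Basis_vec_def inner_axis prod.neutral)
      finally show "0 < emeasure lborel Q" by simp
    qed
  qed
  have "of_nat CARD('n) \<le> hausdorff_dim ?E"
    unfolding hausdorff_dim_def nat_eq
  proof (intro INF_greatest ennreal_leI)
    fix s assume "s \<in> {s. 0 \<le> s \<and> hausdorff_measure s ?E = 0}"
    then show "real CARD('n) \<le> s" using nonzero[of s] by (auto simp: not_less[symmetric])
  qed
  moreover have "hausdorff_dim ?E \<le> of_nat CARD('n)"
    unfolding nat_eq
  \<comment> \<open>Measure zero is available only for exponents strictly above
    \<open>CARD('n)\<close>, so the infimum is approached from above.\<close>
  proof (rule ennreal_le_epsilon)
    fix e :: real assume e: "0 < e"
    have "hausdorff_measure (real CARD('n) + e) ?E = 0"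
      using e by (intro hausdorff_measure_unit_cube_zero cantor_cube_unit) auto
    then have "hausdorff_dim ?E \<le> ennreal (real CARD('n) + e)"
      unfolding hausdorff_dim_def using e by (intro INF_lower) auto
    then show "hausdorff_dim ?E \<le> ennreal (real CARD('n)) + ennreal e"
      using e by (simp add: ennreal_plus)
  qed
  ultimately show ?thesis by (rule antisym[rotated])
qed

text \<open>Take \<open>N = 2 ^ digit_pos m\<close> at a gap of length at least \<open>l\<close>.
  The interval length in \<open>cantor_set\<close> then serves as \<open>\<delta>\<close>, and
  \<open>N * \<delta>\<close> is at most \<open>2 / 2 ^ l\<close>, hence below
  \<open>\<epsilon>\<close>.\<close>

lemma cantor_cube_near_lattice:
  assumes "0 < \<epsilon>"
  shows "\<exists>(N::nat) \<delta>. 0 < N \<and> 0 \<le> \<delta> \<and> real N * \<delta> \<le> \<epsilon> \<and>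
      (\<forall>\<xi>\<in>(cantor_cube :: (real^'n::finite) set). \<forall>i. \<exists>a::nat. real a / real N \<le> \<xi> $ i \<and> \<xi> $ i \<le> real a / real N + \<delta>)"
proof -
  obtain l :: nat where l: "2 / \<epsilon> < 2 ^ l" using real_arch_pow[of 2] by auto
  obtain m where m: "digit_pos m + l \<le> digit_pos (Suc m)" using digit_pos_gap by blast
  define \<delta> :: real where "\<delta> = 2 / 2 ^ digit_pos (Suc m)"
  have "(2::real) ^ digit_pos m * 2 ^ l \<le> 2 ^ digit_pos (Suc m)"
    using m by (simp add: power_increasing flip: power_add)
  moreover have "2 * 2 ^ digit_pos m \<le> \<epsilon> * (2 ^ digit_pos m * 2 ^ l)"
  proof -
    have "2 \<le> \<epsilon> * 2 ^ l" using l assms by (simp add: field_simps)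
    then have "2 * 2 ^ digit_pos m \<le> (\<epsilon> * 2 ^ l) * (2::real) ^ digit_pos m" by (rule mult_right_mono) simp
    then show ?thesis by (simp add: mult_ac)
  qed
  ultimately have "2 * 2 ^ digit_pos m \<le> \<epsilon> * 2 ^ digit_pos (Suc m)"
    using assms by (meson mult_left_mono less_imp_le order_trans)
  then have "real (2 ^ digit_pos m) * \<delta> \<le> \<epsilon>"
    by (simp add: \<delta>_def divide_le_eq mult.commute)
  moreover have "\<exists>a::nat. real a / real (2 ^ digit_pos m) \<le> \<xi> $ i \<and> \<xi> $ i \<le> real a / real (2 ^ digit_pos m) + \<delta>"
    if "\<xi> \<in> cantor_cube" for \<xi> :: "real^'n" and i
  proof -
    have "\<xi> $ i \<in> cantor_set" using that by (simp add: cantor_cube_def)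
    then show ?thesis unfolding cantor_set_def \<delta>_def by fastforce
  qed
  ultimately show ?thesis
    by (intro exI[of _ "2 ^ digit_pos m"] exI[of _ \<delta>]) (auto simp: \<delta>_def)
qed

theorem corollary2:
  shows "\<exists>E :: (real^'n::finite) set.
    compact E \<and> hausdorff_dim E = of_nat CARD('n) \<and>
    (\<forall>(\<mu> :: (real^'n) measure) (p :: real) (q :: ennreal).
       sets \<mu> = sets borel \<longrightarrow> emeasure \<mu> E > 0 \<longrightarrow> 1 < p \<longrightarrow> p \<le> 2 \<longrightarrow> 1 \<le> q \<longrightarrow>
       (SUP f \<in> {f \<in> schwartz_space. f \<noteq> (\<lambda>x. 0)}.
          Lp_norm \<mu> q (fourier f) / Lp_norm lborel (ennreal p) f) = \<infinity>)"
proof (intro exI conjI allI impI)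
  show "compact (cantor_cube :: (real^'n) set)" by (rule compact_cantor_cube)
  show "hausdorff_dim (cantor_cube :: (real^'n) set) = of_nat CARD('n)" by (rule hausdorff_dim_cantor_cube)
  fix \<mu> :: "(real^'n) measure" and p :: real and q :: ennreal
  assume \<mu>: "sets \<mu> = sets borel" "0 < emeasure \<mu> cantor_cube" and "1 < p" "p \<le> 2" "1 \<le> q"
  have "cantor_cube \<in> sets \<mu>"
    unfolding \<mu>(1) by (intro borel_closed compact_imp_closed compact_cantor_cube)
  then show "(SUP f \<in> {f \<in> schwartz_space. f \<noteq> (\<lambda>x. 0)}.
      Lp_norm \<mu> q (fourier f) / Lp_norm lborel (ennreal p) f) = \<infinity>"
    using \<mu>(2) cantor_cube_unit cantor_cube_near_lattice \<open>1 < p\<close> \<open>1 \<le> q\<close>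
    by (rule restriction_unbounded)
qed

end
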